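(* Let $T$ be a recursively axiomatizable extension of Robinson arithmetic $Q$, and let the $\Sigma_1$ formula $\varphi(v_0,v_1)$, the closed term $t$ and the number $n$ be those constructed from $T$ in the context. (i) If $T$ is consistent, then $T\not\vdash\neg\varphi(n,t)$. (ii) If $T$ is $\omega$-consistent, then $T\not\vdash\varphi(n,t)$.
   Context: **Language and basic notions.** Fix a standard first-order language of arithmetic (with equality, constant $0$, unary function symbol $s$, binary function symbols $+,\cdot$, order $\le$ primitive or defined; $x<y$ means $x\le y\wedge x\ne y$). Formulas, sentences and terms are those of this language; the variables $v_0,v_1,v_2,\dots$ each count as one primitive symbol, and apart from the variables there are only finitely many primitive symbols. Terms are written with infix $\cdot$ and parentheses. A theory is an arbitrary set of sentences. $Q$ is Robinson arithmetic, with axioms $s(x)\neq 0$; $s(x)=s(y)\to x=y$; $x\ne0\to\exists y\,(x=s(y))$; $x+0=x$; $x+s(y)=s(x+y)$; $x\cdot 0=0$; $x\cdot s(y)=x\cdot y+x$; $x\le y\leftrightarrow\exists z\,(z+x=y)$. An extension of $Q$ is a theory proving all axioms of $Q$. $\omega$ denotes the standard model (and the set of natural numbers); "true" and "definable" mean true and definable in $\omega$. For $i\in\omega$, $\underline{i}$ is the numeral $s\cdots s0$ ($i$ occurrences of $s$); $i$ is written for $\underline i$ inside formulas. Fix a standard Gödel numbering; $\ulcorner\mu\urcorner$ is the Gödel number of $\mu$. A theory is recursively axiomatizable if it has the same theorems as some theory whose set of Gödel numbers is recursive. A formula is $\Sigma_1$ if it is of the form $(\exists v_i)\mu$ with $\mu$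 a $\Delta_0$ (bounded) formula. $T$ is $\omega$-consistent if for every formula $\eta(v_i)$, $T\vdash(\exists v_i)\eta(v_i)$ implies $T\not\vdash\neg\eta(j)$ for some number $j$ ($\omega$-consistency implies consistency). **Length and naming.** $|e|$ is the number of symbol occurrences in a term or formula $e$ (its length). A formula $\mu$ names the number $i$ if $\mu=\mu(v_0)$ has at most the free variable $v_0$ and $T\vdash(\forall v_0)(\mu(v_0)\leftrightarrow v_0=i)$. **The relation $\mathcal B$ and the formulas $\varphi,\psi$.** Fix a recursive function $g$ such that for every formula $\mu$ and number $j$: if all variables of $\mu$ are among the first $j$ variables $v_0,\dots,v_{j-1}$ and $|\mu|<j$, then $\ulcorner\mu\urcorner<g(j)$ (such a $g$ exists). Let $$\mathcal B=\{(i,j)\in\omega^2:\ \text{there is a formula }\mu\text{ with }\ulcorner\mu\urcorner<g(j),\ |\mu|<j,\text{ and }\mu\text{ names }i\}.$$ Since $T$ is recursively axiomatizable, $\mathcal B$ is recursively enumerable. Let $\varphi(v_0,v_1)$ be a $\Sigma_1$ formula with at most the free variables $v_0,v_1$ defining $\mathcal B$ (with bound variables such that the substitution below is free). Let $$\psi(v_0,v_1):=\neg\varphi(v_0,v_1)\wedge(\forall v_2<v_0)\,\varphi(v_2,v_1).$$ **The term $t$ and the number $n$.** Let $k_1=|\psi(v_0,v_1)|$, let $k_2$ be any natural number greater than the number of free occurrences of $v_1$ in $\psi(v_0,v_1)$, let $k=k_1k_2$, and let $t$ be the closed term $\underline{10}\cdot(\underline{k}\cdot\underline{k})$, with value $\mathbf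 t=10k^2$. If $T$ is a consistent extension of $Q$, only finitely many numbers can be named by formulas of length less than $\mathbf t$; $n$ is the least number that cannot be named by a formula of length less than $\mathbf t$. *)

theory Defs
  imports Main "HOL-Library.Nat_Bijection"
begin

text \<open>The variable \<open>v\<^sub>i\<close> is \<open>Var i\<close>. The order \<open>\<le>\<close> is primitive; \<open>\<leftrightarrow>\<close> and \<open><\<close> are abbreviations.\<close>

datatype tm = Var nat | Zero | Succ tm | Plus tm tm | Times tm tm

datatype fm =
    Eq tm tm
  | Le tm tm
  | Neg fm
  | And fm fm
  | Or fm fm
  | Imp fm fm
  | All nat fm
  | Ex nat fm

abbreviation Iff :: "fm \<Rightarrow> fm \<Rightarrow> fm" where
  "Iff p q \<equiv> And (Imp p q) (Imp q p)"

abbreviation Lt :: "tm \<Rightarrow> tm \<Rightarrow> fm" where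
  "Lt a b \<equiv> And (Le a b) (Neg (Eq a b))"

abbreviation all_le :: "nat \<Rightarrow> tm \<Rightarrow> fm \<Rightarrow> fm" where
  "all_le x a p \<equiv> All x (Imp (Le (Var x) a) p)"

abbreviation ex_le :: "nat \<Rightarrow> tm \<Rightarrow> fm \<Rightarrow> fm" where
  "ex_le x a p \<equiv> Ex x (And (Le (Var x) a) p)"

abbreviation all_lt :: "nat \<Rightarrow> tm \<Rightarrow> fm \<Rightarrow> fm" where
  "all_lt x a p \<equiv> All x (Imp (Lt (Var x) a) p)"

abbreviation ex_lt :: "nat \<Rightarrow> tm \<Rightarrow> fm \<Rightarrow> fm" where
  "ex_lt x a p \<equiv> Ex x (And (Lt (Var x) a) p)"

fun numl :: "nat \<Rightarrow> tm" where
  "numl 0 = Zero"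
| "numl (Suc i) = Succ (numl i)"

fun tm_vars :: "tm \<Rightarrow> nat set" where
  "tm_vars (Var x) = {x}"
| "tm_vars Zero = {}"
| "tm_vars (Succ a) = tm_vars a"
| "tm_vars (Plus a b) = tm_vars a \<union> tm_vars b"
| "tm_vars (Times a b) = tm_vars a \<union> tm_vars b"

text \<open>All variables of a formula, whether free, bound, or occurring only next to a quantifier.\<close>

fun vars :: "fm \<Rightarrow> nat set" where
  "vars (Eq a b) = tm_vars a \<union> tm_vars b"
| "vars (Le a b) = tm_vars a \<union> tm_vars b"
| "vars (Neg p) = vars p"
| "vars (And p q) = vars p \<union> vars q"
| "vars (Or p q) = vars p \<union> vars q"
| "vars (Imp p q) = vars p \<union> vars q"
| "vars (All x p) = insert x (vars p)"
| "vars (Ex x p) = insert x (vars p)"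

fun fv :: "fm \<Rightarrow> nat set" where
  "fv (Eq a b) = tm_vars a \<union> tm_vars b"
| "fv (Le a b) = tm_vars a \<union> tm_vars b"
| "fv (Neg p) = fv p"
| "fv (And p q) = fv p \<union> fv q"
| "fv (Or p q) = fv p \<union> fv q"
| "fv (Imp p q) = fv p \<union> fv q"
| "fv (All x p) = fv p - {x}"
| "fv (Ex x p) = fv p - {x}"

fun tm_occ :: "nat \<Rightarrow> tm \<Rightarrow> nat" where
  "tm_occ x (Var y) = (if x = y then 1 else 0)"
| "tm_occ x Zero = 0"
| "tm_occ x (Succ a) = tm_occ x a"
| "tm_occ x (Plus a b) = tm_occ x a + tm_occ x b"
| "tm_occ x (Times a b) = tm_occ x a + tm_occ x b"

fun free_occ :: "nat \<Rightarrow> fm \<Rightarrow> nat" where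
  "free_occ x (Eq a b) = tm_occ x a + tm_occ x b"
| "free_occ x (Le a b) = tm_occ x a + tm_occ x b"
| "free_occ x (Neg p) = free_occ x p"
| "free_occ x (And p q) = free_occ x p + free_occ x q"
| "free_occ x (Or p q) = free_occ x p + free_occ x q"
| "free_occ x (Imp p q) = free_occ x p + free_occ x q"
| "free_occ x (All y p) = (if x = y then 0 else free_occ x p)"
| "free_occ x (Ex y p) = (if x = y then 0 else free_occ x p)"

fun tm_subst :: "nat \<Rightarrow> tm \<Rightarrow> tm \<Rightarrow> tm" where
  "tm_subst x c (Var y) = (if x = y then c else Var y)"
| "tm_subst x c Zero = Zero"
| "tm_subst x c (Succ a) = Succ (tm_subst x c a)"
| "tm_subst x c (Plus a b) = Plus (tm_subst x c a) (tm_subst x c b)"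
| "tm_subst x c (Times a b) = Times (tm_subst x c a) (tm_subst x c b)"

text \<open>\<open>subst x c p\<close> literally replaces the free occurrences of \<open>v\<^sub>x\<close> in \<open>p\<close> by \<open>c\<close>; bound variables
  are never renamed, so it is the intended operation only if \<open>free_for c x p\<close> (which always holds
  for closed \<open>c\<close>).\<close>

fun subst :: "nat \<Rightarrow> tm \<Rightarrow> fm \<Rightarrow> fm" where
  "subst x c (Eq a b) = Eq (tm_subst x c a) (tm_subst x c b)"
| "subst x c (Le a b) = Le (tm_subst x c a) (tm_subst x c b)"
| "subst x c (Neg p) = Neg (subst x c p)"
| "subst x c (And p q) = And (subst x c p) (subst x c q)"
| "subst x c (Or p q) = Or (subst x c p) (subst x c q)"
| "subst x c (Imp p q) = Imp (subst x c p) (subst x c q)"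
| "subst x c (All y p) = (if x = y then All y p else All y (subst x c p))"
| "subst x c (Ex y p) = (if x = y then Ex y p else Ex y (subst x c p))"

fun free_for :: "tm \<Rightarrow> nat \<Rightarrow> fm \<Rightarrow> bool" where
  "free_for c x (Eq a b) = True"
| "free_for c x (Le a b) = True"
| "free_for c x (Neg p) = free_for c x p"
| "free_for c x (And p q) = (free_for c x p \<and> free_for c x q)"
| "free_for c x (Or p q) = (free_for c x p \<and> free_for c x q)"
| "free_for c x (Imp p q) = (free_for c x p \<and> free_for c x q)"
| "free_for c x (All y p) = (x \<notin> fv (All y p) \<or> (y \<notin> tm_vars c \<and> free_for c x p))"
| "free_for c x (Ex y p) = (x \<notin> fv (Ex y p) \<or> (y \<notin> tm_vars c \<and> free_for c x p))"

datatype symbol =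
    SVar nat | SZero | SSucc | SPlus | STimes | SEq | SLe
  | SNeg | SAnd | SOr | SImp | SAll | SEx | SLPar | SRPar

fun tm_syms :: "tm \<Rightarrow> symbol list" where
  "tm_syms (Var x) = [SVar x]"
| "tm_syms Zero = [SZero]"
| "tm_syms (Succ a) = SSucc # tm_syms a"
| "tm_syms (Plus a b) = [SLPar] @ tm_syms a @ [SPlus] @ tm_syms b @ [SRPar]"
| "tm_syms (Times a b) = [SLPar] @ tm_syms a @ [STimes] @ tm_syms b @ [SRPar]"

fun syms :: "fm \<Rightarrow> symbol list" where
  "syms (Eq a b) = tm_syms a @ [SEq] @ tm_syms b"
| "syms (Le a b) = tm_syms a @ [SLe] @ tm_syms b"
| "syms (Neg p) = SNeg # syms p"
| "syms (And p q) = [SLPar] @ syms p @ [SAnd] @ syms q @ [SRPar]"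
| "syms (Or p q) = [SLPar] @ syms p @ [SOr] @ syms q @ [SRPar]"
| "syms (Imp p q) = [SLPar] @ syms p @ [SImp] @ syms q @ [SRPar]"
| "syms (All x p) = [SLPar, SAll, SVar x, SRPar] @ syms p"
| "syms (Ex x p) = [SLPar, SEx, SVar x, SRPar] @ syms p"

definition len :: "fm \<Rightarrow> nat" where
  "len p = length (syms p)"

fun tm_code :: "tm \<Rightarrow> nat" where
  "tm_code (Var x) = prod_encode (0, x)"
| "tm_code Zero = prod_encode (1, 0)"
| "tm_code (Succ a) = prod_encode (2, tm_code a)"
| "tm_code (Plus a b) = prod_encode (3, prod_encode (tm_code a, tm_code b))"
| "tm_code (Times a b) = prod_encode (4, prod_encode (tm_code a, tm_code b))"

fun gn :: "fm \<Rightarrow> nat" where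
  "gn (Eq a b) = prod_encode (0, prod_encode (tm_code a, tm_code b))"
| "gn (Le a b) = prod_encode (1, prod_encode (tm_code a, tm_code b))"
| "gn (Neg p) = prod_encode (2, gn p)"
| "gn (And p q) = prod_encode (3, prod_encode (gn p, gn q))"
| "gn (Or p q) = prod_encode (4, prod_encode (gn p, gn q))"
| "gn (Imp p q) = prod_encode (5, prod_encode (gn p, gn q))"
| "gn (All x p) = prod_encode (6, prod_encode (x, gn p))"
| "gn (Ex x p) = prod_encode (7, prod_encode (x, gn p))"

lemma tm_code_inject: "tm_code a = tm_code b \<Longrightarrow> a = b"
proof (induction a arbitrary: b)
  case (Var x) then show ?case by (cases b) auto
next
  case Zero then show ?case by (cases b) auto
next
  case (Succ a) then show ?case by (cases b) auto
next
  case (Plus a1 a2) then show ?case by (cases b) auto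
next
  case (Times a1 a2) then show ?case by (cases b) auto
qed

lemma gn_inject: "gn p = gn q \<Longrightarrow> p = q"
proof (induction p arbitrary: q)
  case (Eq a b) then show ?case by (cases q) (auto dest: tm_code_inject)
next
  case (Le a b) then show ?case by (cases q) (auto dest: tm_code_inject)
next
  case (Neg p) then show ?case by (cases q) auto
next
  case (And p1 p2) then show ?case by (cases q) auto
next
  case (Or p1 p2) then show ?case by (cases q) auto
next
  case (Imp p1 p2) then show ?case by (cases q) auto
next
  case (All x p) then show ?case by (cases q) auto
next
  case (Ex x p) then show ?case by (cases q) auto
qed

fun tm_val :: "(nat \<Rightarrow> nat) \<Rightarrow> tm \<Rightarrow> nat" where
  "tm_val e (Var x) = e x"
| "tm_val e Zero = 0"
| "tm_val e (Succ a) = Suc (tm_val e a)"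
| "tm_val e (Plus a b) = tm_val e a + tm_val e b"
| "tm_val e (Times a b) = tm_val e a * tm_val e b"

fun sat :: "(nat \<Rightarrow> nat) \<Rightarrow> fm \<Rightarrow> bool" where
  "sat e (Eq a b) = (tm_val e a = tm_val e b)"
| "sat e (Le a b) = (tm_val e a \<le> tm_val e b)"
| "sat e (Neg p) = (\<not> sat e p)"
| "sat e (And p q) = (sat e p \<and> sat e q)"
| "sat e (Or p q) = (sat e p \<or> sat e q)"
| "sat e (Imp p q) = (sat e p \<longrightarrow> sat e q)"
| "sat e (All x p) = (\<forall>i. sat (e(x := i)) p)"
| "sat e (Ex x p) = (\<exists>i. sat (e(x := i)) p)"

definition defines_rel :: "fm \<Rightarrow> (nat \<times> nat) set \<Rightarrow> bool" where
  "defines_rel p R \<longleftrightarrow> fv p \<subseteq> {0, 1} \<and> (\<forall>e. sat e p \<longleftrightarrow> (e 0, e 1) \<in> R)"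

inductive delta0 :: "fm \<Rightarrow> bool" where
  "delta0 (Eq a b)"
| "delta0 (Le a b)"
| "delta0 p \<Longrightarrow> delta0 (Neg p)"
| "delta0 p \<Longrightarrow> delta0 q \<Longrightarrow> delta0 (And p q)"
| "delta0 p \<Longrightarrow> delta0 q \<Longrightarrow> delta0 (Or p q)"
| "delta0 p \<Longrightarrow> delta0 q \<Longrightarrow> delta0 (Imp p q)"
| "delta0 p \<Longrightarrow> x \<notin> tm_vars a \<Longrightarrow> delta0 (all_le x a p)"
| "delta0 p \<Longrightarrow> x \<notin> tm_vars a \<Longrightarrow> delta0 (ex_le x a p)"
| "delta0 p \<Longrightarrow> x \<notin> tm_vars a \<Longrightarrow> delta0 (all_lt x a p)"
| "delta0 p \<Longrightarrow> x \<notin> tm_vars a \<Longrightarrow> delta0 (ex_lt x a p)"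

definition sigma1 :: "fm \<Rightarrow> bool" where
  "sigma1 p \<longleftrightarrow> (\<exists>x m. p = Ex x m \<and> delta0 m)"

text \<open>Classical natural deduction with equality. The explicit rule \<open>Weak\<close> is there because the
  eigenvariable conditions refer to the whole, possibly infinite, context.\<close>

inductive prv :: "fm set \<Rightarrow> fm \<Rightarrow> bool" (infix \<open>\<turnstile>\<close> 50) where
  Assm: "p \<in> G \<Longrightarrow> G \<turnstile> p"
| Weak: "G \<turnstile> p \<Longrightarrow> G \<subseteq> H \<Longrightarrow> H \<turnstile> p"
| ImpI: "insert p G \<turnstile> q \<Longrightarrow> G \<turnstile> Imp p q"
| ImpE: "G \<turnstile> Imp p q \<Longrightarrow> G \<turnstile> p \<Longrightarrow> G \<turnstile> q"
| AndI: "G \<turnstile> p \<Longrightarrow> G \<turnstile> q \<Longrightarrow> G \<turnstile> And p q"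
| AndE1: "G \<turnstile> And p q \<Longrightarrow> G \<turnstile> p"
| AndE2: "G \<turnstile> And p q \<Longrightarrow> G \<turnstile> q"
| OrI1: "G \<turnstile> p \<Longrightarrow> G \<turnstile> Or p q"
| OrI2: "G \<turnstile> q \<Longrightarrow> G \<turnstile> Or p q"
| OrE: "G \<turnstile> Or p q \<Longrightarrow> insert p G \<turnstile> r \<Longrightarrow> insert q G \<turnstile> r \<Longrightarrow> G \<turnstile> r"
| NegI: "insert p G \<turnstile> q \<Longrightarrow> insert p G \<turnstile> Neg q \<Longrightarrow> G \<turnstile> Neg p"
| Raa: "insert (Neg p) G \<turnstile> q \<Longrightarrow> insert (Neg p) G \<turnstile> Neg q \<Longrightarrow> G \<turnstile> p"
| AllI: "G \<turnstile> p \<Longrightarrow> \<forall>r\<in>G. x \<notin> fv r \<Longrightarrow> G \<turnstile> All x p"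
| AllE: "G \<turnstile> All x p \<Longrightarrow> free_for c x p \<Longrightarrow> G \<turnstile> subst x c p"
| ExI: "G \<turnstile> subst x c p \<Longrightarrow> free_for c x p \<Longrightarrow> G \<turnstile> Ex x p"
| ExE: "G \<turnstile> Ex x p \<Longrightarrow> insert p G \<turnstile> q \<Longrightarrow> \<forall>r\<in>insert q G. x \<notin> fv r \<Longrightarrow> G \<turnstile> q"
| EqRefl: "G \<turnstile> Eq a a"
| EqSubst: "G \<turnstile> Eq a b \<Longrightarrow> G \<turnstile> subst x a p \<Longrightarrow> free_for a x p \<Longrightarrow> free_for b x p
    \<Longrightarrow> G \<turnstile> subst x b p"

definition is_theory :: "fm set \<Rightarrow> bool" where
  "is_theory T \<longleftrightarrow> (\<forall>p\<in>T. fv p = {})"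

definition consistent :: "fm set \<Rightarrow> bool" where
  "consistent T \<longleftrightarrow> \<not> (\<exists>p. T \<turnstile> p \<and> T \<turnstile> Neg p)"

definition omega_consistent :: "fm set \<Rightarrow> bool" where
  "omega_consistent T \<longleftrightarrow>
    (\<forall>x p. fv p \<subseteq> {x} \<longrightarrow> T \<turnstile> Ex x p \<longrightarrow> (\<exists>j. \<not> T \<turnstile> Neg (subst x (numl j) p)))"

definition Q_axioms :: "fm set" where
  "Q_axioms = {
     All 0 (Neg (Eq (Succ (Var 0)) Zero)),
     All 0 (All 1 (Imp (Eq (Succ (Var 0)) (Succ (Var 1))) (Eq (Var 0) (Var 1)))),
     All 0 (Imp (Neg (Eq (Var 0) Zero)) (Ex 1 (Eq (Var 0) (Succ (Var 1))))),
     All 0 (Eq (Plus (Var 0) Zero) (Var 0)),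
     All 0 (All 1 (Eq (Plus (Var 0) (Succ (Var 1))) (Succ (Plus (Var 0) (Var 1))))),
     All 0 (Eq (Times (Var 0) Zero) Zero),
     All 0 (All 1 (Eq (Times (Var 0) (Succ (Var 1))) (Plus (Times (Var 0) (Var 1)) (Var 0)))),
     All 0 (All 1 (Iff (Le (Var 0) (Var 1)) (Ex 2 (Eq (Plus (Var 2) (Var 0)) (Var 1)))))}"

definition extends_Q :: "fm set \<Rightarrow> bool" where
  "extends_Q T \<longleftrightarrow> is_theory T \<and> (\<forall>p\<in>Q_axioms. T \<turnstile> p)"

text \<open>\<open>recfn n f\<close>: \<open>f\<close> is a total recursive function of arity \<open>n\<close>, its arguments being given as a list
  of length \<open>n\<close>; values on lists of other lengths are irrelevant. Minimization is applied to
  regular functions only, so all functions are total.\<close>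

inductive recfn :: "nat \<Rightarrow> (nat list \<Rightarrow> nat) \<Rightarrow> bool" where
  zero: "recfn n (\<lambda>xs. 0)"
| succ: "recfn 1 (\<lambda>xs. Suc (xs ! 0))"
| proj: "i < n \<Longrightarrow> recfn n (\<lambda>xs. xs ! i)"
| comp: "recfn (length fs) h \<Longrightarrow> \<forall>f\<in>set fs. recfn n f \<Longrightarrow> recfn n (\<lambda>xs. h (map (\<lambda>f. f xs) fs))"
| prim: "recfn n f \<Longrightarrow> recfn (Suc (Suc n)) h \<Longrightarrow>
    recfn (Suc n) (\<lambda>xs. rec_nat (f (tl xs)) (\<lambda>y r. h (y # r # tl xs)) (hd xs))"
| mini: "recfn (Suc n) f \<Longrightarrow> \<forall>xs. length xs = n \<longrightarrow> (\<exists>y. f (y # xs) = 0) \<Longrightarrow>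
    recfn n (\<lambda>xs. LEAST y. f (y # xs) = 0)"

definition recursive :: "(nat \<Rightarrow> nat) \<Rightarrow> bool" where
  "recursive f \<longleftrightarrow> (\<exists>h. recfn 1 h \<and> (\<forall>x. f x = h [x]))"

definition recursive_set :: "nat set \<Rightarrow> bool" where
  "recursive_set A \<longleftrightarrow> recursive (\<lambda>x. if x \<in> A then 1 else 0)"

definition rec_axiomatizable :: "fm set \<Rightarrow> bool" where
  "rec_axiomatizable T \<longleftrightarrow>
    (\<exists>A. is_theory A \<and> recursive_set (gn ` A) \<and> (\<forall>p. T \<turnstile> p \<longleftrightarrow> A \<turnstile> p))"

definition names :: "fm set \<Rightarrow> fm \<Rightarrow> nat \<Rightarrow> bool" where
  "names T m i \<longleftrightarrow> fv m \<subseteq> {0} \<and> T \<turnstile> All 0 (Iff m (Eq (Var 0) (numl i)))"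

definition code_bound :: "(nat \<Rightarrow> nat) \<Rightarrow> bool" where
  "code_bound g \<longleftrightarrow> recursive g \<and> (\<forall>m j. vars m \<subseteq> {..<j} \<and> len m < j \<longrightarrow> gn m < g j)"

definition naming_rel :: "fm set \<Rightarrow> (nat \<Rightarrow> nat) \<Rightarrow> (nat \<times> nat) set" where
  "naming_rel T g = {(i, j). \<exists>m. gn m < g j \<and> len m < j \<and> names T m i}"

definition psi :: "fm \<Rightarrow> fm" where
  "psi p = And (Neg p) (all_lt 2 (Var 0) (subst 0 (Var 2) p))"

definition bound_k :: "fm \<Rightarrow> nat \<Rightarrow> nat" where
  "bound_k p k2 = len (psi p) * k2"

definition term_t :: "fm \<Rightarrow> nat \<Rightarrow> tm" where
  "term_t p k2 = Times (numl 10) (Times (numl (bound_k p k2)) (numl (bound_k p k2)))"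

definition value_t :: "fm \<Rightarrow> nat \<Rightarrow> nat" where
  "value_t p k2 = 10 * (bound_k p k2)\<^sup>2"

definition least_unnamed :: "fm set \<Rightarrow> nat \<Rightarrow> nat" where
  "least_unnamed T l = (LEAST i. \<not> (\<exists>m. len m < l \<and> names T m i))"

definition inst2 :: "fm \<Rightarrow> tm \<Rightarrow> tm \<Rightarrow> fm" where
  "inst2 p a b = subst 1 b (subst 0 a p)"

end

theory Submission imports Defs begin

text \<open>The argument is Boolos' version of Berry's paradox. Every \<open>i < n\<close> is named by a short formula,
  so \<open>\<phi>(i, t)\<close> is true and hence, being \<open>\<Sigma>\<^sub>1\<close>, provable. If \<open>\<not> \<phi>(n, t)\<close> were provable as well, then
  \<open>\<psi>(v\<^sub>0, t)\<close> would name \<open>n\<close>; since \<open>t\<close> denotes \<open>10 k\<^sup>2\<close> with only \<open>O(k)\<close> symbols, this formula has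
  length less than the value of \<open>t\<close>, a contradiction. For the second part, \<open>\<phi>(n, t)\<close> is false by
  the choice of \<open>n\<close>, so each instance of its \<open>\<Delta>\<^sub>0\<close> matrix is refutable. Bound variables have to
  be renamed, because \<open>g\<close> bounds only the codes of formulas in the first \<open>j\<close> variables.\<close>

text \<open>Berry's argument counts names by length alone, whereas \<open>naming_rel\<close> also
  bounds their codes. A formula of length below \<open>l\<close> has fewer than \<open>l\<close>
  distinct variables, so an injective renaming that fixes \<open>v_0\<close> carries it into the
  first \<open>l\<close> variables. The code bound therefore excludes no number. Since naming means
  provability of an equivalence, the effect of the renaming has to be justified inside the calculus.

  On the arithmetical side the obstacle is the weakness of Q, which proves hardly any general law of
  order. Two facts about a fixed numeral \<open>n\<close> suffice: everything \<open>\<le> n\<close>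
  is one of \<open>0, ..., n\<close>, and everything is comparable with \<open>n\<close>. Both come
  from induction on \<open>n\<close> outside the theory. The first decides bounded formulas;
  together they let the least-number formula \<open>psi\<close> single out \<open>n\<close>.\<close>

section \<open>Variables and literal substitution\<close>

lemma finite_tm_vars: "finite (tm_vars a)"
  by (induction a) auto

lemma finite_vars: "finite (vars p)"
  by (induction p) (auto simp: finite_tm_vars)

lemma fv_subset_vars: "fv p \<subseteq> vars p"
  by (induction p) auto

lemma tm_vars_numl [simp]: "tm_vars (numl i) = {}"
  by (induction i) auto

lemma tm_subst_fresh: "x \<notin> tm_vars a \<Longrightarrow> tm_subst x c a = a"
  by (induction a) auto

lemma tm_subst_numl [simp]: "tm_subst x c (numl i) = numl i"
  by (simp add: tm_subst_fresh)

lemma tm_subst_Var_same [simp]: "tm_subst x (Var x) a = a"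
  by (induction a) auto

lemma subst_fresh: "x \<notin> fv p \<Longrightarrow> subst x c p = p"
  by (induction p) (auto simp: tm_subst_fresh)

lemma subst_Var_same [simp]: "subst x (Var x) p = p"
  by (induction p) auto

lemma free_for_disjoint: "tm_vars c \<inter> vars p = {} \<Longrightarrow> free_for c x p"
  by (induction p) auto

lemma free_for_fresh: "x \<notin> fv p \<Longrightarrow> free_for c x p"
  by (induction p) auto

lemma free_for_Var_same [simp]: "free_for (Var x) x p"
  by (induction p) auto

lemma free_for_closed: "tm_vars c = {} \<Longrightarrow> free_for c x p"
  by (simp add: free_for_disjoint)

lemma free_for_numl [simp]: "free_for (numl i) x p"
  by (simp add: free_for_closed)

lemma tm_vars_subst_closed: "tm_vars c = {} \<Longrightarrow> tm_vars (tm_subst x c a) = tm_vars a - {x}"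
  by (induction a) auto

lemma fv_subst_closed: "tm_vars c = {} \<Longrightarrow> fv (subst x c p) = fv p - {x}"
  by (induction p) (auto simp: tm_vars_subst_closed)

lemma tm_vars_subst_Var: "tm_vars (tm_subst x (Var y) a) \<subseteq> insert y (tm_vars a - {x})"
  by (induction a) auto

lemma free_for_subst_closed:
  "tm_vars c = {} \<Longrightarrow> free_for d x p \<Longrightarrow> free_for d x (subst y c p)"
  by (induction p) (auto simp: fv_subst_closed)

lemma fv_subst_Var: "fv (subst x (Var y) p) \<subseteq> insert y (fv p - {x})"
  by (induction p) (auto dest!: subsetD[OF tm_vars_subst_Var])

lemma tm_subst_Var_subst:
  "y \<notin> tm_vars a \<Longrightarrow> tm_subst y c (tm_subst x (Var y) a) = tm_subst x c a"
  by (induction a) auto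

text \<open>Inside \<open>psi\<close> the formula appears with \<open>v_2\<close> in place of
  \<open>v_0\<close>; this turns instances of that copy back into instances of the original.\<close>

lemma subst_Var_subst:
  "y \<notin> fv p \<Longrightarrow> free_for (Var y) x p \<Longrightarrow> subst y c (subst x (Var y) p) = subst x c p"
  by (induction p) (auto simp: tm_subst_Var_subst subst_fresh)

lemma tm_subst_commute_closed:
  "x \<noteq> y \<Longrightarrow> tm_vars c = {} \<Longrightarrow> x \<notin> tm_vars d \<Longrightarrow>
    tm_subst x c (tm_subst y d a) = tm_subst y d (tm_subst x c a)"
  by (induction a) (auto simp: tm_subst_fresh)

lemma subst_commute_closed:
  "x \<noteq> y \<Longrightarrow> tm_vars c = {} \<Longrightarrow> x \<notin> tm_vars d \<Longrightarrow>
    subst x c (subst y d p) = subst y d (subst x c p)"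
  by (induction p) (auto intro: tm_subst_commute_closed)

section \<open>Derived rules\<close>

lemma prv_head: "insert p G \<turnstile> p"
  by (rule Assm) simp

lemma prv_weak: "G \<turnstile> q \<Longrightarrow> insert p G \<turnstile> q"
  by (erule Weak) auto

lemma prv_cut: "G \<turnstile> p \<Longrightarrow> insert p G \<turnstile> q \<Longrightarrow> G \<turnstile> q"
  by (blast intro: ImpI ImpE)

lemma prv_contr: "G \<turnstile> p \<Longrightarrow> G \<turnstile> Neg p \<Longrightarrow> G \<turnstile> q"
  by (rule Raa[of _ _ p]) (auto intro: prv_weak)

lemma prv_cases:
  assumes "insert p G \<turnstile> q" "insert (Neg p) G \<turnstile> q"
  shows "G \<turnstile> q"
proof (rule Raa)
  let ?G = "insert (Neg q) G"
  have "?G \<turnstile> Neg p"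
  proof (rule NegI)
    show "insert p ?G \<turnstile> q" using assms(1) by (rule Weak) auto
    show "insert p ?G \<turnstile> Neg q" by (rule Assm) simp
  qed
  moreover have "insert (Neg p) ?G \<turnstile> q" using assms(2) by (rule Weak) auto
  ultimately show "?G \<turnstile> q" by (rule prv_cut)
  show "?G \<turnstile> Neg q" by (rule prv_head)
qed

lemma prv_ImpD: "G \<turnstile> Imp p q \<Longrightarrow> insert p G \<turnstile> q"
  by (blast intro: ImpE prv_weak prv_head)

lemma IffI: "insert p G \<turnstile> q \<Longrightarrow> insert q G \<turnstile> p \<Longrightarrow> G \<turnstile> Iff p q"
  by (blast intro: AndI ImpI)

text \<open>The fresh \<open>x\<close> is a hole in the formula handed to \<open>EqSubst\<close>:
  only the marked place changes, while the other occurrences of \<open>a\<close> stay fixed. The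
  congruence rules below use the same device.\<close>

lemma eq_sym:
  assumes "G \<turnstile> Eq a b" shows "G \<turnstile> Eq b a"
proof -
  obtain x where x: "x \<notin> tm_vars a"
    using ex_new_if_finite[OF infinite_UNIV_nat finite_tm_vars] by blast
  have "G \<turnstile> subst x b (Eq (Var x) a)"
    by (rule EqSubst[OF assms]) (auto simp: tm_subst_fresh x EqRefl)
  then show ?thesis by (simp add: tm_subst_fresh x)
qed

lemma eq_trans:
  assumes "G \<turnstile> Eq a b" "G \<turnstile> Eq b c" shows "G \<turnstile> Eq a c"
proof -
  obtain x where x: "x \<notin> tm_vars a"
    using ex_new_if_finite[OF infinite_UNIV_nat finite_tm_vars] by blast
  have "G \<turnstile> subst x c (Eq a (Var x))"
    by (rule EqSubst[OF assms(2)]) (auto simp: tm_subst_fresh x assms(1))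
  then show ?thesis by (simp add: tm_subst_fresh x)
qed

lemma eq_Succ:
  assumes "G \<turnstile> Eq a b" shows "G \<turnstile> Eq (Succ a) (Succ b)"
proof -
  obtain x where x: "x \<notin> tm_vars a"
    using ex_new_if_finite[OF infinite_UNIV_nat finite_tm_vars] by blast
  have "G \<turnstile> subst x b (Eq (Succ a) (Succ (Var x)))"
    by (rule EqSubst[OF assms]) (auto simp: tm_subst_fresh x EqRefl)
  then show ?thesis by (simp add: tm_subst_fresh x)
qed

lemma ex_fresh_for_four: "\<exists>x. x \<notin> tm_vars a \<and> x \<notin> tm_vars b \<and> x \<notin> tm_vars c \<and> x \<notin> tm_vars d"
  using ex_new_if_finite[OF infinite_UNIV_nat, of "tm_vars a \<union> tm_vars b \<union> tm_vars c \<union> tm_vars d"]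
  by (auto simp: finite_tm_vars)

lemma eq_Plus:
  assumes "G \<turnstile> Eq a a'" "G \<turnstile> Eq b b'" shows "G \<turnstile> Eq (Plus a b) (Plus a' b')"
proof -
  obtain x where x: "x \<notin> tm_vars a" "x \<notin> tm_vars b" "x \<notin> tm_vars a'"
    using ex_fresh_for_four by blast
  have "G \<turnstile> subst x a' (Eq (Plus a b) (Plus (Var x) b))"
    by (rule EqSubst[OF assms(1)]) (auto simp: tm_subst_fresh x EqRefl)
  moreover have "G \<turnstile> subst x b' (Eq (Plus a' b) (Plus a' (Var x)))"
    by (rule EqSubst[OF assms(2)]) (auto simp: tm_subst_fresh x EqRefl)
  ultimately show ?thesis by (auto simp: tm_subst_fresh x intro: eq_trans)
qed

lemma eq_Times:
  assumes "G \<turnstile> Eq a a'" "G \<turnstile> Eq b b'" shows "G \<turnstile> Eq (Times a b) (Times a' b')"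
proof -
  obtain x where x: "x \<notin> tm_vars a" "x \<notin> tm_vars b" "x \<notin> tm_vars a'"
    using ex_fresh_for_four by blast
  have "G \<turnstile> subst x a' (Eq (Times a b) (Times (Var x) b))"
    by (rule EqSubst[OF assms(1)]) (auto simp: tm_subst_fresh x EqRefl)
  moreover have "G \<turnstile> subst x b' (Eq (Times a' b) (Times a' (Var x)))"
    by (rule EqSubst[OF assms(2)]) (auto simp: tm_subst_fresh x EqRefl)
  ultimately show ?thesis by (auto simp: tm_subst_fresh x intro: eq_trans)
qed

lemma Eq_cong:
  assumes "G \<turnstile> Eq a a'" "G \<turnstile> Eq b b'" "G \<turnstile> Eq a b" shows "G \<turnstile> Eq a' b'"
  using assms by (blast intro: eq_trans eq_sym)

lemma Le_cong:
  assumes "G \<turnstile> Eq a a'" "G \<turnstile> Eq b b'" "G \<turnstile> Le a b" shows "G \<turnstile> Le a' b'"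
proof -
  obtain x where x: "x \<notin> tm_vars b" "x \<notin> tm_vars a'"
    using ex_fresh_for_four by blast
  have "G \<turnstile> subst x a' (Le (Var x) b)"
    by (rule EqSubst[OF assms(1)]) (auto simp: tm_subst_fresh x assms(3))
  then have "G \<turnstile> subst x b' (Le a' (Var x))"
    by (intro EqSubst[OF assms(2)]) (auto simp: tm_subst_fresh x)
  then show ?thesis by (auto simp: tm_subst_fresh x)
qed

text \<open>This lets truth in \<open>\<omega>\<close> under an assignment \<open>e\<close> be expressed by contexts of equations
  \<open>x = numl (e x)\<close>, without simultaneous substitution.\<close>

lemma prv_subst_of_eq:
  assumes p: "insert (Eq (Var x) b) G \<turnstile> p" and G: "\<forall>r\<in>G. x \<notin> fv r"
    and c: "tm_vars c = {}" and cb: "G \<turnstile> Eq c b"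
  shows "G \<turnstile> subst x c p"
proof -
  have "insert (Eq (Var x) c) G \<turnstile> Eq (Var x) b"
    by (blast intro: eq_trans prv_head prv_weak cb)
  moreover have "insert (Eq (Var x) b) (insert (Eq (Var x) c) G) \<turnstile> p"
    using p by (rule Weak) auto
  ultimately have "G \<turnstile> Imp (Eq (Var x) c) p"
    by (blast intro: ImpI prv_cut)
  then have "G \<turnstile> All x (Imp (Eq (Var x) c) p)" using G by (rule AllI)
  then have "G \<turnstile> subst x c (Imp (Eq (Var x) c) p)"
    by (rule AllE) (simp add: free_for_closed c)
  then show ?thesis
    using c by (auto simp: tm_subst_fresh intro: ImpE EqRefl)
qed

section \<open>Renaming of variables\<close>

primrec tm_rename :: "(nat \<Rightarrow> nat) \<Rightarrow> tm \<Rightarrow> tm" where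
  "tm_rename f (Var x) = Var (f x)"
| "tm_rename f Zero = Zero"
| "tm_rename f (Succ a) = Succ (tm_rename f a)"
| "tm_rename f (Plus a b) = Plus (tm_rename f a) (tm_rename f b)"
| "tm_rename f (Times a b) = Times (tm_rename f a) (tm_rename f b)"

text \<open>Bound variables are moved along with free ones, so injectivity on \<open>vars p\<close>
  is all that is needed to avoid capture.\<close>

primrec rename :: "(nat \<Rightarrow> nat) \<Rightarrow> fm \<Rightarrow> fm" where
  "rename f (Eq a b) = Eq (tm_rename f a) (tm_rename f b)"
| "rename f (Le a b) = Le (tm_rename f a) (tm_rename f b)"
| "rename f (Neg p) = Neg (rename f p)"
| "rename f (And p q) = And (rename f p) (rename f q)"
| "rename f (Or p q) = Or (rename f p) (rename f q)"
| "rename f (Imp p q) = Imp (rename f p) (rename f q)"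
| "rename f (All x p) = All (f x) (rename f p)"
| "rename f (Ex x p) = Ex (f x) (rename f p)"

lemma tm_vars_rename: "tm_vars (tm_rename f a) = f ` tm_vars a"
  by (induction a) auto

lemma vars_rename: "vars (rename f p) = f ` vars p"
  by (induction p) (auto simp: tm_vars_rename)

lemma fv_rename: "inj_on f (vars p) \<Longrightarrow> fv (rename f p) = f ` fv p"
proof (induction p)
  case (All x p)
  then have "inj_on f (insert x (fv p))"
    using fv_subset_vars[of p] by (auto intro: inj_on_subset)
  with All show ?case by (auto simp: inj_on_def)
next
  case (Ex x p)
  then have "inj_on f (insert x (fv p))"
    using fv_subset_vars[of p] by (auto intro: inj_on_subset)
  with Ex show ?case by (auto simp: inj_on_def)
qed (auto simp: tm_vars_rename inj_on_Un image_Un)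

lemma tm_rename_numl [simp]: "tm_rename f (numl i) = numl i"
  by (induction i) auto

lemma tm_rename_rename:
  "(\<And>x. x \<in> tm_vars a \<Longrightarrow> g (f x) = h x) \<Longrightarrow> tm_rename g (tm_rename f a) = tm_rename h a"
  by (induction a) auto

lemma rename_rename:
  "(\<And>x. x \<in> vars p \<Longrightarrow> g (f x) = h x) \<Longrightarrow> rename g (rename f p) = rename h p"
  by (induction p) (auto intro!: tm_rename_rename)

lemma len_rename: "len (rename f p) = len p"
proof -
  have tm: "length (tm_syms (tm_rename f a)) = length (tm_syms a)" for a
    by (induction a) auto
  show ?thesis unfolding len_def by (induction p) (auto simp: tm)
qed

text \<open>Only sentences are renamed in the end, but the induction passes through open
  subformulas, and these agree with their renamings only under such equations.\<close>

definition var_eqs :: "(nat \<Rightarrow> nat) \<Rightarrow> nat set \<Rightarrow> fm set" where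
  "var_eqs f X = (\<lambda>x. Eq (Var x) (Var (f x))) ` X"

lemma tm_rename_prv: "tm_vars a \<subseteq> X \<Longrightarrow> var_eqs f X \<turnstile> Eq a (tm_rename f a)"
  by (induction a) (auto simp: var_eqs_def intro: eq_Plus eq_Times eq_Succ EqRefl Assm)

text \<open>The equation is moved from the context into the formula as a guard and generalized over
  \<open>x\<close>. Instantiating \<open>x\<close> by \<open>y\<close> makes the guard
  \<open>y = y\<close> and leaves \<open>q\<close> unchanged, as \<open>x\<close> is not free in
  it.\<close>

lemma All_rename:
  assumes pq: "insert (Eq (Var x) (Var y)) G \<turnstile> Imp p q" and G: "\<forall>r\<in>G. x \<notin> fv r \<and> y \<notin> fv r"
    and y: "y \<notin> vars p" and x: "x \<notin> vars q" and xy: "x \<noteq> y"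
  shows "G \<turnstile> Imp (All x p) (All y q)"
proof (rule ImpI, rule AllI)
  let ?G = "insert (All x p) G"
  have xq: "x \<notin> fv q" and yp: "y \<notin> fv p" using x y fv_subset_vars by auto
  have "?G \<turnstile> subst x (Var x) p" by (rule AllE[OF prv_head]) simp
  then have "insert (Eq (Var x) (Var y)) ?G \<turnstile> p" by (simp add: prv_weak)
  moreover have "insert (Eq (Var x) (Var y)) ?G \<turnstile> Imp p q"
    using pq by (rule Weak) auto
  ultimately have "?G \<turnstile> Imp (Eq (Var x) (Var y)) q"
    by (blast intro: ImpI ImpE)
  then have "?G \<turnstile> All x (Imp (Eq (Var x) (Var y)) q)"
    using G by (auto intro: AllI)
  then have "?G \<turnstile> subst x (Var y) (Imp (Eq (Var x) (Var y)) q)"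
    by (rule AllE) (simp add: free_for_fresh xq)
  then show "?G \<turnstile> q"
    using xy by (auto simp: subst_fresh[OF xq] intro: ImpE EqRefl)
  show "\<forall>r\<in>?G. y \<notin> fv r" using G yp by auto
qed

lemma Ex_rename:
  assumes pq: "insert (Eq (Var x) (Var y)) G \<turnstile> Imp p q" and G: "\<forall>r\<in>G. x \<notin> fv r \<and> y \<notin> fv r"
    and y: "y \<notin> vars p" and x: "x \<notin> vars q" and xy: "x \<noteq> y"
  shows "G \<turnstile> Imp (Ex x p) (Ex y q)"
proof (rule ImpI, rule ExE[OF prv_head])
  let ?G = "insert p (insert (Ex x p) G)"
  have xq: "x \<notin> fv q" and yp: "y \<notin> fv p" using x y fv_subset_vars by auto
  have free: "free_for (Var x) y q" using x by (simp add: free_for_disjoint)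
  have "insert (Eq (Var x) (Var y)) ?G \<turnstile> Imp p q"
    using pq by (rule Weak) auto
  then have "insert (Eq (Var x) (Var y)) ?G \<turnstile> q"
    by (rule ImpE) (simp add: Assm)
  then have "?G \<turnstile> All y (Imp (Eq (Var x) (Var y)) q)"
    using G yp by (auto intro!: AllI ImpI)
  \<comment> \<open>Dually to the universal case, the eigenvariable \<open>x\<close> is itself the
    witness for \<open>y\<close>, and the guard becomes \<open>x = x\<close>.\<close>
  then have "?G \<turnstile> subst y (Var x) (Imp (Eq (Var x) (Var y)) q)"
    by (rule AllE) (simp add: free)
  then have "?G \<turnstile> subst y (Var x) q"
    using xy by (auto intro: ImpE EqRefl)
  then show "?G \<turnstile> Ex y q" using free by (rule ExI)
  show "\<forall>r\<in>insert (Ex y q) (insert (Ex x p) G). x \<notin> fv r" using G xq by auto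
qed

lemma prv_swap_eq:
  assumes "insert (Eq a b) G \<turnstile> p" shows "insert (Eq b a) G \<turnstile> p"
proof (rule prv_cut)
  show "insert (Eq b a) G \<turnstile> Eq a b" by (rule eq_sym[OF prv_head])
  show "insert (Eq a b) (insert (Eq b a) G) \<turnstile> p" using assms by (rule Weak) auto
qed

lemma Imp_Neg:
  assumes "G \<turnstile> Imp q p" shows "G \<turnstile> Imp (Neg p) (Neg q)"
proof (rule ImpI, rule NegI)
  show "insert q (insert (Neg p) G) \<turnstile> p"
    using prv_ImpD[OF assms] by (rule Weak) auto
  show "insert q (insert (Neg p) G) \<turnstile> Neg p" by (rule Assm) simp
qed

lemma Imp_And:
  assumes "G \<turnstile> Imp p p'" "G \<turnstile> Imp q q'" shows "G \<turnstile> Imp (And p q) (And p' q')"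
  by (rule ImpI)
    (blast intro: AndI AndE1[OF prv_head] AndE2[OF prv_head] ImpE prv_weak assms)

lemma Imp_Or:
  assumes "G \<turnstile> Imp p p'" "G \<turnstile> Imp q q'" shows "G \<turnstile> Imp (Or p q) (Or p' q')"
proof (rule ImpI, rule OrE[OF prv_head])
  show "insert p (insert (Or p q) G) \<turnstile> Or p' q'"
    using prv_ImpD[OF assms(1)] by (rule OrI1[OF Weak]) auto
  show "insert q (insert (Or p q) G) \<turnstile> Or p' q'"
    using prv_ImpD[OF assms(2)] by (rule OrI2[OF Weak]) auto
qed

lemma Imp_Imp:
  assumes "G \<turnstile> Imp p' p" "G \<turnstile> Imp q q'" shows "G \<turnstile> Imp (Imp p q) (Imp p' q')"
proof (rule ImpI, rule ImpI)
  let ?G = "insert p' (insert (Imp p q) G)"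
  have "?G \<turnstile> p" using prv_ImpD[OF assms(1)] by (rule Weak) auto
  moreover have "?G \<turnstile> Imp p q" by (rule Assm) simp
  ultimately have "?G \<turnstile> q" by (blast intro: ImpE)
  moreover have "?G \<turnstile> Imp q q'" using assms(2) by (rule Weak) auto
  ultimately show "?G \<turnstile> q'" by (blast intro: ImpE)
qed

text \<open>Both implications go through one induction because \<open>Neg\<close> and the premise of
  \<open>Imp\<close> exchange them. Disjointness of old and new variables guarantees that the
  equation \<open>x = f x\<close>, which the context gains under a quantifier, interferes with no
  other equation and can be discharged by \<open>All_rename\<close> or
  \<open>Ex_rename\<close>.\<close>

lemma rename_prv_iff:
  assumes "inj_on f (vars p)" "f ` vars p \<inter> vars p = {}"
  shows "var_eqs f (fv p) \<turnstile> Imp p (rename f p) \<and> var_eqs f (fv p) \<turnstile> Imp (rename f p) p"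
  using assms
proof (induction p)
  case (Eq a b)
  have ab: "var_eqs f (fv (fm.Eq a b)) \<turnstile> fm.Eq a (tm_rename f a)"
    "var_eqs f (fv (fm.Eq a b)) \<turnstile> fm.Eq b (tm_rename f b)"
    by (auto intro: tm_rename_prv)
  show ?case
    unfolding rename.simps
    by (intro conjI ImpI)
      (rule Eq_cong[OF _ _ prv_head]; intro prv_weak ab ab[THEN eq_sym])+
next
  case (Le a b)
  have ab: "var_eqs f (fv (Le a b)) \<turnstile> fm.Eq a (tm_rename f a)"
    "var_eqs f (fv (Le a b)) \<turnstile> fm.Eq b (tm_rename f b)"
    by (auto intro: tm_rename_prv)
  show ?case
    unfolding rename.simps
    by (intro conjI ImpI)
      (rule Le_cong[OF _ _ prv_head]; intro prv_weak ab ab[THEN eq_sym])+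
next
  case (Neg p)
  then show ?case by (auto intro: Imp_Neg)
next
  case (And p q)
  then have ih:
    "var_eqs f (fv p) \<turnstile> Imp p (rename f p)" "var_eqs f (fv p) \<turnstile> Imp (rename f p) p"
    "var_eqs f (fv q) \<turnstile> Imp q (rename f q)" "var_eqs f (fv q) \<turnstile> Imp (rename f q) q"
    by (auto simp: inj_on_Un)
  show ?case
    unfolding rename.simps fv.simps var_eqs_def image_Un
    by (intro conjI Imp_And ih[unfolded var_eqs_def, THEN Weak]) auto
next
  case (Or p q)
  then have ih:
    "var_eqs f (fv p) \<turnstile> Imp p (rename f p)" "var_eqs f (fv p) \<turnstile> Imp (rename f p) p"
    "var_eqs f (fv q) \<turnstile> Imp q (rename f q)" "var_eqs f (fv q) \<turnstile> Imp (rename f q) q"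
    by (auto simp: inj_on_Un)
  show ?case
    unfolding rename.simps fv.simps var_eqs_def image_Un
    by (intro conjI Imp_Or ih[unfolded var_eqs_def, THEN Weak]) auto
next
  case (Imp p q)
  then have ih:
    "var_eqs f (fv p) \<turnstile> fm.Imp p (rename f p)" "var_eqs f (fv p) \<turnstile> fm.Imp (rename f p) p"
    "var_eqs f (fv q) \<turnstile> fm.Imp q (rename f q)" "var_eqs f (fv q) \<turnstile> fm.Imp (rename f q) q"
    by (auto simp: inj_on_Un)
  show ?case
    unfolding rename.simps fv.simps var_eqs_def image_Un
    by (intro conjI Imp_Imp ih[unfolded var_eqs_def, THEN Weak]) auto
next
  case (All x p)
  let ?G = "var_eqs f (fv p - {x})"
  have ih: "var_eqs f (fv p) \<turnstile> Imp p (rename f p)" "var_eqs f (fv p) \<turnstile> Imp (rename f p) p"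
    using All by auto
  have sub: "var_eqs f (fv p) \<subseteq> insert (fm.Eq (Var x) (Var (f x))) ?G"
    by (auto simp: var_eqs_def)
  have fresh: "\<forall>r\<in>?G. x \<notin> fv r \<and> f x \<notin> fv r" "f x \<notin> vars p" "x \<notin> vars (rename f p)" "x \<noteq> f x"
    using All.prems fv_subset_vars[of p] by (auto simp: var_eqs_def vars_rename inj_on_def)
  show ?case
    using All_rename[OF Weak[OF ih(1) sub]] All_rename[OF prv_swap_eq[OF Weak[OF ih(2) sub]]] fresh
    by auto
next
  case (Ex x p)
  let ?G = "var_eqs f (fv p - {x})"
  have ih: "var_eqs f (fv p) \<turnstile> Imp p (rename f p)" "var_eqs f (fv p) \<turnstile> Imp (rename f p) p"
    using Ex by auto
  have sub: "var_eqs f (fv p) \<subseteq> insert (fm.Eq (Var x) (Var (f x))) ?G"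
    by (auto simp: var_eqs_def)
  have fresh: "\<forall>r\<in>?G. x \<notin> fv r \<and> f x \<notin> fv r" "f x \<notin> vars p" "x \<notin> vars (rename f p)" "x \<noteq> f x"
    using Ex.prems fv_subset_vars[of p] by (auto simp: var_eqs_def vars_rename inj_on_def)
  show ?case
    using Ex_rename[OF Weak[OF ih(1) sub]] Ex_rename[OF prv_swap_eq[OF Weak[OF ih(2) sub]]] fresh
    by auto
qed

lemma rename_prv_disjoint:
  assumes "inj_on f (vars p)" "f ` vars p \<inter> vars p = {}" "fv p = {}"
  shows "G \<turnstile> p \<longleftrightarrow> G \<turnstile> rename f p"
proof -
  have "{} \<turnstile> Imp p (rename f p)" "{} \<turnstile> Imp (rename f p) p"
    using rename_prv_iff[of f p] assms by (auto simp: var_eqs_def)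
  then have "G \<turnstile> Imp p (rename f p)" "G \<turnstile> Imp (rename f p) p"
    by (auto elim: Weak)
  then show ?thesis by (blast intro: ImpE)
qed

text \<open>Renaming first to variables beyond all those involved makes the two renamings disjoint.\<close>

lemma rename_prv:
  assumes inj: "inj_on f (vars p)" and closed: "fv p = {}"
  shows "G \<turnstile> p \<longleftrightarrow> G \<turnstile> rename f p"
proof -
  obtain N where N: "\<forall>x \<in> vars p \<union> f ` vars p. x < N"
    using finite_vars[of p] finite_nat_set_iff_bounded[of "vars p \<union> f ` vars p"] by auto
  let ?s = "\<lambda>x. x + N" and ?u = "\<lambda>x. f (x - N)"
  have "G \<turnstile> p \<longleftrightarrow> G \<turnstile> rename ?s p"
    using closed N by (intro rename_prv_disjoint) (auto simp: inj_on_def)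
  also have "\<dots> \<longleftrightarrow> G \<turnstile> rename ?u (rename ?s p)"
  proof (rule rename_prv_disjoint)
    show "inj_on ?u (vars (rename ?s p))" using inj by (auto simp: vars_rename inj_on_def)
    show "?u ` vars (rename ?s p) \<inter> vars (rename ?s p) = {}"
      using N by (force simp: vars_rename)
    show "fv (rename ?s p) = {}" using closed by (simp add: fv_rename)
  qed
  also have "rename ?u (rename ?s p) = rename f p"
    by (rule rename_rename) simp
  finally show ?thesis .
qed

section \<open>Consequences of Robinson arithmetic\<close>

lemma NegI_self: "insert p G \<turnstile> Neg p \<Longrightarrow> G \<turnstile> Neg p"
  by (rule NegI[OF prv_head])

text \<open>Substituting the numeral for \<open>x\<close> turns the equation into a reflexive one
  and touches nothing else. In this way a witness or counterexample can be assumed by an equation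
  and dropped afterwards.\<close>

lemma prv_discard_eq:
  assumes "insert (Eq (Var x) (numl i)) G \<turnstile> p" "\<forall>r\<in>G. x \<notin> fv r" "x \<notin> fv p"
  shows "G \<turnstile> p"
  using prv_subst_of_eq[OF assms(1,2) _ EqRefl] assms(3) by (simp add: subst_fresh)

text \<open>The guard \<open>b\<close> and its range \<open>B\<close> stay abstract so that one
  proof covers the bounds \<open>Le\<close> and \<open>Lt\<close>. Arithmetic enters only through
  \<open>upper\<close>, the elimination rule by cases for the guard, and \<open>b\<close>, its
  introduction rule.\<close>

lemma bounded_All_decides:
  assumes G: "\<forall>r\<in>G. x \<notin> fv r"
    and upper: "\<And>r. (\<And>i. i \<in> B \<Longrightarrow> insert (Eq (Var x) (numl i)) G \<turnstile> r) \<Longrightarrow> insert b G \<turnstile> r"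
    and b: "\<And>i. i \<in> B \<Longrightarrow> insert (Eq (Var x) (numl i)) G \<turnstile> b"
    and p: "\<And>i. insert (Eq (Var x) (numl i)) G \<turnstile> (if P i then p else Neg p)"
  shows "G \<turnstile> (if \<forall>i\<in>B. P i then All x (Imp b p) else Neg (All x (Imp b p)))"
proof (cases "\<forall>i\<in>B. P i")
  case True
  have "insert b G \<turnstile> p"
  proof (rule upper)
    fix i assume "i \<in> B"
    with True p[of i] show "insert (Eq (Var x) (numl i)) G \<turnstile> p" by simp
  qed
  then have "G \<turnstile> All x (Imp b p)" by (intro AllI ImpI G)
  then show ?thesis unfolding if_P[OF True] .
next
  case False
  then obtain i where i: "i \<in> B" "\<not> P i" by blast
  have "G \<turnstile> Neg (All x (Imp b p))"
  proof (rule NegI_self, rule prv_discard_eq)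
    let ?H = "insert (Eq (Var x) (numl i)) (insert (All x (Imp b p)) G)"
    have "?H \<turnstile> subst x (Var x) (Imp b p)" by (rule AllE) (auto intro: Assm)
    then have "?H \<turnstile> Imp b p" by (simp del: subst.simps)
    moreover have "?H \<turnstile> b" using b[OF i(1)] by (rule Weak) auto
    moreover have "insert (Eq (Var x) (numl i)) G \<turnstile> Neg p" using p[of i] i(2) by simp
    then have "?H \<turnstile> Neg p" by (rule Weak) auto
    ultimately show "?H \<turnstile> Neg (All x (Imp b p))" by (blast intro: prv_contr ImpE)
  qed (use G in auto)
  then show ?thesis unfolding if_not_P[OF False] .
qed

lemma bounded_Ex_decides:
  assumes G: "\<forall>r\<in>G. x \<notin> fv r"
    and upper: "\<And>r. (\<And>i. i \<in> B \<Longrightarrow> insert (Eq (Var x) (numl i)) G \<turnstile> r) \<Longrightarrow> insert b G \<turnstile> r"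
    and b: "\<And>i. i \<in> B \<Longrightarrow> insert (Eq (Var x) (numl i)) G \<turnstile> b"
    and p: "\<And>i. insert (Eq (Var x) (numl i)) G \<turnstile> (if P i then p else Neg p)"
  shows "G \<turnstile> (if \<exists>i\<in>B. P i then Ex x (And b p) else Neg (Ex x (And b p)))"
proof (cases "\<exists>i\<in>B. P i")
  case True
  then obtain i where i: "i \<in> B" "P i" by blast
  have "G \<turnstile> Ex x (And b p)"
  proof (rule prv_discard_eq[OF ExI])
    show "insert (Eq (Var x) (numl i)) G \<turnstile> subst x (Var x) (And b p)"
      using b[OF i(1)] p[of i] i(2) by (simp del: subst.simps add: AndI)
  qed (use G in auto)
  then show ?thesis unfolding if_P[OF True] .
next
  case False
  have "insert b G \<turnstile> Neg p"
  proof (rule upper)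
    fix i assume "i \<in> B"
    with False p[of i] show "insert (Eq (Var x) (numl i)) G \<turnstile> Neg p" by simp
  qed
  then have p: "insert b (insert (And b p) (insert (Ex x (And b p)) G)) \<turnstile> Neg p"
    by (rule Weak) auto
  have "G \<turnstile> Neg (Ex x (And b p))"
  proof (rule NegI_self, rule ExE[OF prv_head])
    let ?H = "insert (And b p) (insert (Ex x (And b p)) G)"
    have "?H \<turnstile> Neg p" by (rule prv_cut[OF AndE1[OF prv_head] p])
    then show "?H \<turnstile> Neg (Ex x (And b p))" by (rule prv_contr[OF AndE2[OF prv_head]])
  qed (use G in auto)
  then show ?thesis unfolding if_not_P[OF False] .
qed

text \<open>The finite disjunction that \<open>Le a (numl n)\<close> is shown to imply in Q.\<close>

fun eq_upto :: "nat \<Rightarrow> tm \<Rightarrow> fm" where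
  "eq_upto 0 a = Eq a Zero"
| "eq_upto (Suc n) a = Or (eq_upto n a) (Eq a (numl (Suc n)))"

lemma subst_eq_upto [simp]: "subst x c (eq_upto n a) = eq_upto n (tm_subst x c a)"
  by (induction n) auto

lemma free_for_eq_upto [simp]: "free_for c x (eq_upto n a)"
  by (induction n) auto

lemma fv_eq_upto [simp]: "fv (eq_upto n a) = tm_vars a"
  by (induction n) auto

lemma eq_uptoI: "i \<le> n \<Longrightarrow> G \<turnstile> Eq a (numl i) \<Longrightarrow> G \<turnstile> eq_upto n a"
proof (induction n)
  case (Suc n)
  then show ?case by (cases "i = Suc n") (auto intro: OrI1 OrI2)
qed auto

lemma eq_uptoE:
  "G \<turnstile> eq_upto n a \<Longrightarrow> (\<And>i. i \<le> n \<Longrightarrow> insert (Eq a (numl i)) G \<turnstile> r) \<Longrightarrow> G \<turnstile> r"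
proof (induction n arbitrary: G)
  case 0
  have "insert (Eq a (numl 0)) G \<turnstile> r" by (rule 0) simp
  with 0(1) show ?case by (auto intro: prv_cut)
next
  case (Suc n)
  let ?G = "insert (eq_upto n a) G"
  have "?G \<turnstile> r"
  proof (rule Suc.IH[OF prv_head])
    fix i assume "i \<le> n"
    then show "insert (Eq a (numl i)) ?G \<turnstile> r" by (intro Weak[OF Suc.prems(2)[of i]]) auto
  qed
  then show ?case
    using Suc.prems(2)[of "Suc n"]
    by (intro OrE[OF Suc.prems(1)[unfolded eq_upto.simps]]) (auto simp del: numl.simps)
qed

lemma tm_val_upd: "x \<notin> tm_vars a \<Longrightarrow> tm_val (e(x := i)) a = tm_val e a"
  by (induction a) auto

text \<open>The assignment is recorded only on \<open>X\<close>: with the free variables of a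
  quantified formula for \<open>X\<close>, the context does not mention the quantified variable, as
  the eigenvariable conditions require.\<close>

definition val_eqs :: "(nat \<Rightarrow> nat) \<Rightarrow> nat set \<Rightarrow> fm set" where
  "val_eqs e X = (\<lambda>x. Eq (Var x) (numl (e x))) ` X"

section \<open>Axiom instances and computation with numerals\<close>

locale Q_extension =
  fixes T :: "fm set"
  assumes extends_Q: "extends_Q T"
begin

lemma fv_T: "\<forall>r\<in>T. x \<notin> fv r"
  using extends_Q by (auto simp: extends_Q_def is_theory_def)

lemma T_Q: "p \<in> Q_axioms \<Longrightarrow> T \<turnstile> p"
  using extends_Q by (auto simp: extends_Q_def)

text \<open>The term for \<open>v_0\<close> goes in under the quantifier of \<open>v_1\<close>;
  hence the hypothesis \<open>1 \<notin> tm_vars a\<close> in the instances of the two-variable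
  axioms.\<close>

lemma All2E:
  assumes "G \<turnstile> All 0 (All 1 p)" "free_for a 0 (All 1 p)" "free_for b 1 (subst 0 a p)"
  shows "G \<turnstile> subst 1 b (subst 0 a p)"
  using AllE[OF assms(1,2)] assms(3) by (auto intro: AllE)

lemma Succ_neq_Zero: "T \<turnstile> Neg (Eq (Succ a) Zero)"
proof -
  have "T \<turnstile> All 0 (Neg (Eq (Succ (Var 0)) Zero))" by (rule T_Q) (simp add: Q_axioms_def)
  from AllE[OF this, of a] show ?thesis by simp
qed

lemma Succ_inj: "1 \<notin> tm_vars a \<Longrightarrow> T \<turnstile> Imp (Eq (Succ a) (Succ b)) (Eq a b)"
proof -
  assume a: "1 \<notin> tm_vars a"
  have "T \<turnstile> All 0 (All 1 (Imp (Eq (Succ (Var 0)) (Succ (Var 1))) (Eq (Var 0) (Var 1))))"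
    by (rule T_Q) (simp add: Q_axioms_def)
  from All2E[OF this, of a b] show ?thesis using a by (simp add: tm_subst_fresh)
qed

text \<open>The bound variable of the axiom is changed to \<open>v\<^sub>3\<close>, because \<open>v\<^sub>1\<close> would be captured when the
  axiom for \<open>\<le>\<close> is instantiated with the predecessor.\<close>

lemma Succ_cases:
  assumes a: "1 \<notin> tm_vars a" "3 \<notin> tm_vars a"
  shows "T \<turnstile> Imp (Neg (Eq a Zero)) (Ex 3 (Eq a (Succ (Var 3))))"
proof (rule ImpI)
  have "T \<turnstile> All 0 (Imp (Neg (Eq (Var 0) Zero)) (Ex 1 (Eq (Var 0) (Succ (Var 1)))))"
    by (rule T_Q) (simp add: Q_axioms_def)
  from AllE[OF this, of a] have "T \<turnstile> Imp (Neg (Eq a Zero)) (Ex 1 (Eq a (Succ (Var 1))))"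
    using a by simp
  then have *: "insert (Neg (Eq a Zero)) T \<turnstile> Ex 1 (Eq a (Succ (Var 1)))" by (rule prv_ImpD)
  show "insert (Neg (Eq a Zero)) T \<turnstile> Ex 3 (Eq a (Succ (Var 3)))"
  proof (rule ExE[OF *])
    show "insert (Eq a (Succ (Var 1))) (insert (Neg (Eq a Zero)) T) \<turnstile> Ex 3 (Eq a (Succ (Var 3)))"
      by (rule ExI[where c = "Var 1"]) (auto simp: tm_subst_fresh a prv_head)
  qed (use a fv_T in auto)
qed

lemma Plus_Zero: "T \<turnstile> Eq (Plus a Zero) a"
proof -
  have "T \<turnstile> All 0 (Eq (Plus (Var 0) Zero) (Var 0))" by (rule T_Q) (simp add: Q_axioms_def)
  from AllE[OF this, of a] show ?thesis by simp
qed

lemma Plus_Succ: "1 \<notin> tm_vars a \<Longrightarrow> T \<turnstile> Eq (Plus a (Succ b)) (Succ (Plus a b))"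
proof -
  assume a: "1 \<notin> tm_vars a"
  have "T \<turnstile> All 0 (All 1 (Eq (Plus (Var 0) (Succ (Var 1))) (Succ (Plus (Var 0) (Var 1)))))"
    by (rule T_Q) (simp add: Q_axioms_def)
  from All2E[OF this, of a b] show ?thesis using a by (simp add: tm_subst_fresh)
qed

lemma Times_Zero: "T \<turnstile> Eq (Times a Zero) Zero"
proof -
  have "T \<turnstile> All 0 (Eq (Times (Var 0) Zero) Zero)" by (rule T_Q) (simp add: Q_axioms_def)
  from AllE[OF this, of a] show ?thesis by simp
qed

lemma Times_Succ: "1 \<notin> tm_vars a \<Longrightarrow> T \<turnstile> Eq (Times a (Succ b)) (Plus (Times a b) a)"
proof -
  assume a: "1 \<notin> tm_vars a"
  have "T \<turnstile> All 0 (All 1 (Eq (Times (Var 0) (Succ (Var 1))) (Plus (Times (Var 0) (Var 1)) (Var 0))))"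
    by (rule T_Q) (simp add: Q_axioms_def)
  from All2E[OF this, of a b] show ?thesis using a by (simp add: tm_subst_fresh)
qed

lemma Le_iff:
  assumes "1 \<notin> tm_vars a" "2 \<notin> tm_vars a" "2 \<notin> tm_vars b"
  shows "T \<turnstile> Iff (Le a b) (Ex 2 (Eq (Plus (Var 2) a) b))"
proof -
  have "T \<turnstile> All 0 (All 1 (Iff (Le (Var 0) (Var 1)) (Ex 2 (Eq (Plus (Var 2) (Var 0)) (Var 1)))))"
    by (rule T_Q) (simp add: Q_axioms_def)
  from All2E[OF this, of a b] show ?thesis using assms by (simp add: tm_subst_fresh)
qed

lemma numl_Plus: "T \<turnstile> Eq (Plus (numl i) (numl j)) (numl (i + j))"
proof (induction j)
  case 0
  then show ?case using Plus_Zero by simp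
next
  case (Suc j)
  then show ?case using eq_trans[OF Plus_Succ eq_Succ[OF Suc]] by simp
qed

lemma numl_Times: "T \<turnstile> Eq (Times (numl i) (numl j)) (numl (i * j))"
proof (induction j)
  case 0
  then show ?case using Times_Zero by simp
next
  case (Suc j)
  have "T \<turnstile> Eq (Times (numl i) (Succ (numl j))) (Plus (numl (i * j)) (numl i))"
    by (rule eq_trans[OF Times_Succ eq_Plus[OF Suc EqRefl]]) simp
  from eq_trans[OF this numl_Plus] show ?case by (simp add: add.commute)
qed

lemma tm_eval:
  assumes "T \<subseteq> G"
  shows "(\<And>x. x \<in> tm_vars a \<Longrightarrow> G \<turnstile> Eq (Var x) (numl (e x))) \<Longrightarrow> G \<turnstile> Eq a (numl (tm_val e a))"
proof (induction a)
  case (Plus a b)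
  then show ?case
    using eq_trans[OF eq_Plus Weak[OF numl_Plus assms]] by simp
next
  case (Times a b)
  then show ?case
    using eq_trans[OF eq_Times Weak[OF numl_Times assms]] by simp
qed (auto intro: EqRefl eq_Succ)

lemma numl_neq: "i \<noteq> j \<Longrightarrow> T \<turnstile> Neg (Eq (numl i) (numl j))"
proof (induction i arbitrary: j)
  case 0
  then obtain m where j: "j = Suc m" by (cases j) auto
  show ?case unfolding j
    by (rule NegI[OF eq_sym[OF prv_head] prv_weak]) (simp add: Succ_neq_Zero)
next
  case (Suc i)
  show ?case
  proof (cases j)
    case 0
    then show ?thesis by (simp add: Succ_neq_Zero)
  next
    case j: (Suc m)
    have "insert (Eq (Succ (numl i)) (Succ (numl m))) T \<turnstile> Eq (numl i) (numl m)"
      by (rule prv_ImpD[OF Succ_inj]) simp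
    moreover have "T \<turnstile> Neg (Eq (numl i) (numl m))" using Suc j by simp
    ultimately show ?thesis unfolding j numl.simps by (rule NegI[OF _ prv_weak])
  qed
qed

lemma numl_Le: "i \<le> j \<Longrightarrow> T \<turnstile> Le (numl i) (numl j)"
proof -
  assume "i \<le> j"
  then have "T \<turnstile> Eq (Plus (numl (j - i)) (numl i)) (numl j)"
    using numl_Plus[of "j - i" i] by simp
  then have "T \<turnstile> Ex 2 (Eq (Plus (Var 2) (numl i)) (numl j))"
    by (intro ExI[where c = "numl (j - i)"]) auto
  then show ?thesis
    by (rule ImpE[OF AndE2[OF Le_iff], rotated -1]) auto
qed

section \<open>Order against a fixed numeral\<close>

text \<open>Let \<open>z + x = n\<close>. Either \<open>x\<close> is zero, or \<open>x\<close> is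
  the successor of some \<open>y\<close> and \<open>s(z + y) = n\<close>. The latter is absurd for
  \<open>n = 0\<close>, and for \<open>n = m + 1\<close> it gives \<open>z + y = m\<close>, so the
  induction hypothesis applies to \<open>y\<close>. The statement is universally quantified so that
  it can be instantiated with this predecessor.\<close>

lemma Le_eq_upto: "T \<turnstile> All 0 (Imp (Le (Var 0) (numl n)) (eq_upto n (Var 0)))"
proof (induction n)
  \<comment> \<open>Base case and induction step share the zero-or-successor split; only the
    successor branch \<open>pred\<close> differs. There \<open>v_2\<close> is the summand
    \<open>z\<close> and \<open>v_3\<close> the predecessor.\<close>
  have step: "T \<turnstile> All 0 (Imp (Le (Var 0) (numl n)) (eq_upto n (Var 0)))"
    if pred: "\<And>G. T \<subseteq> G \<Longrightarrow> G \<turnstile> Eq (Var 0) (Succ (Var 3)) \<Longrightarrow>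
      G \<turnstile> Eq (Succ (Plus (Var 2) (Var 3))) (numl n) \<Longrightarrow> G \<turnstile> eq_upto n (Var 0)" for n
  proof (rule AllI[OF ImpI fv_T])
    let ?G = "insert (Le (Var 0) (numl n)) T"
    let ?H = "insert (Eq (Plus (Var 2) (Var 0)) (numl n)) ?G"
    let ?K = "insert (Neg (Eq (Var 0) Zero)) ?H"
    let ?L = "insert (Eq (Var 0) (Succ (Var 3))) ?K"
    have Ex: "?G \<turnstile> Ex 2 (Eq (Plus (Var 2) (Var 0)) (numl n))"
      by (rule prv_ImpD[OF AndE1[OF Le_iff]]) auto
    have "?K \<turnstile> Imp (Neg (Eq (Var 0) Zero)) (Ex 3 (Eq (Var 0) (Succ (Var 3))))"
      by (rule Weak[OF Succ_cases]) auto
    then have pre: "?K \<turnstile> Ex 3 (Eq (Var 0) (Succ (Var 3)))" by (rule ImpE) (rule prv_head)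
    have head: "?L \<turnstile> Eq (Var 0) (Succ (Var 3))" by (rule prv_head)
    have "?L \<turnstile> Eq (Plus (Var 2) (Var 0)) (Plus (Var 2) (Succ (Var 3)))"
      by (intro eq_Plus EqRefl head)
    moreover have "?L \<turnstile> Eq (Plus (Var 2) (Succ (Var 3))) (Succ (Plus (Var 2) (Var 3)))"
      by (rule Weak[OF Plus_Succ]) auto
    moreover have "?L \<turnstile> Eq (Plus (Var 2) (Var 0)) (numl n)" by (rule Assm) simp
    ultimately have "?L \<turnstile> Eq (Succ (Plus (Var 2) (Var 3))) (numl n)"
      by (meson eq_sym eq_trans)
    then have "?L \<turnstile> eq_upto n (Var 0)" by (intro pred head) auto
    then have "?K \<turnstile> eq_upto n (Var 0)"
      by (rule ExE[OF pre]) (use fv_T in auto)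
    moreover have "insert (Eq (Var 0) Zero) ?H \<turnstile> eq_upto n (Var 0)"
      by (rule eq_uptoI[of 0]) (auto intro: prv_head)
    ultimately have "?H \<turnstile> eq_upto n (Var 0)" by (blast intro: prv_cases)
    then show "?G \<turnstile> eq_upto n (Var 0)"
      by (rule ExE[OF Ex]) (use fv_T in auto)
  qed
  {
    case 0
    show ?case
    proof (rule step)
      fix G assume "T \<subseteq> G" "G \<turnstile> Eq (Succ (Plus (Var 2) (Var 3))) (numl 0)"
      then show "G \<turnstile> eq_upto 0 (Var 0)"
        unfolding numl.simps by (rule prv_contr[OF _ Weak[OF Succ_neq_Zero], rotated])
    qed
  next
    case (Suc m)
    show ?case
    proof (rule step)
      fix G assume TG: "T \<subseteq> G" and v0: "G \<turnstile> Eq (Var 0) (Succ (Var 3))"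
        and "G \<turnstile> Eq (Succ (Plus (Var 2) (Var 3))) (numl (Suc m))"
      then have "G \<turnstile> Eq (Succ (numl m)) (Succ (Plus (Var 2) (Var 3)))" by (simp add: eq_sym)
      then have "G \<turnstile> Eq (numl m) (Plus (Var 2) (Var 3))"
        by (rule ImpE[OF Weak[OF Succ_inj TG], rotated]) auto
      then have "G \<turnstile> Eq (Plus (Var 2) (Var 3)) (numl m)" by (rule eq_sym)
      then have "G \<turnstile> Ex 2 (Eq (Plus (Var 2) (Var 3)) (numl m))"
        by (intro ExI[where c = "Var 2"]) auto
      then have Le: "G \<turnstile> Le (Var 3) (numl m)"
        by (rule ImpE[OF AndE2[OF Weak[OF Le_iff TG]], rotated -1]) auto
      have "G \<turnstile> Imp (Le (Var 3) (numl m)) (eq_upto m (Var 3))"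
        using AllE[OF Weak[OF Suc TG], of "Var 3"] by simp
      from this Le have "G \<turnstile> eq_upto m (Var 3)" by (rule ImpE)
      then show "G \<turnstile> eq_upto (Suc m) (Var 0)"
      proof (rule eq_uptoE)
        fix i assume "i \<le> m"
        moreover have "insert (Eq (Var 3) (numl i)) G \<turnstile> Eq (Var 0) (numl (Suc i))"
          using eq_trans[OF prv_weak[OF v0] eq_Succ[OF prv_head]] by simp
        ultimately show "insert (Eq (Var 3) (numl i)) G \<turnstile> eq_upto (Suc m) (Var 0)"
          by (intro eq_uptoI[of "Suc i"]) auto
      qed
    qed
  }
qed

lemma Le_numlE:
  assumes "G \<turnstile> Le a (numl n)" "T \<subseteq> G" "\<And>i. i \<le> n \<Longrightarrow> insert (Eq a (numl i)) G \<turnstile> r"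
  shows "G \<turnstile> r"
proof -
  have "G \<turnstile> Imp (Le a (numl n)) (eq_upto n a)"
    using AllE[OF Weak[OF Le_eq_upto assms(2)], of a] by simp
  then have "G \<turnstile> eq_upto n a" using assms(1) by (rule ImpE)
  then show ?thesis using assms(3) by (rule eq_uptoE)
qed

lemma numl_not_Le: "j < i \<Longrightarrow> T \<turnstile> Neg (Le (numl i) (numl j))"
proof (rule NegI_self, rule Le_numlE[OF prv_head])
  fix m assume "j < i" "m \<le> j"
  then have "T \<turnstile> Neg (Eq (numl i) (numl m))" by (intro numl_neq) auto
  then show "insert (Eq (numl i) (numl m)) (insert (Le (numl i) (numl j)) T) \<turnstile>
      Neg (Le (numl i) (numl j))"
    by (rule prv_contr[OF prv_head prv_weak[OF prv_weak]])
qed auto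

text \<open>Q cannot move a successor across a sum in general; with a numeral as second summand,
  induction outside the theory does it.\<close>

lemma Succ_Plus_numl:
  assumes "1 \<notin> tm_vars a"
  shows "T \<turnstile> Eq (Plus (Succ a) (numl n)) (Plus a (Succ (numl n)))"
proof (induction n)
  case 0
  have "T \<turnstile> Eq (Plus (Succ a) Zero) (Succ a)" by (rule Plus_Zero)
  moreover have "T \<turnstile> Eq (Succ (Plus a Zero)) (Succ a)" by (rule eq_Succ[OF Plus_Zero])
  moreover have "T \<turnstile> Eq (Plus a (Succ Zero)) (Succ (Plus a Zero))" using assms by (rule Plus_Succ)
  ultimately show ?case unfolding numl.simps by (meson eq_sym eq_trans)
next
  case (Suc n)
  have "T \<turnstile> Eq (Plus (Succ a) (Succ (numl n))) (Succ (Plus (Succ a) (numl n)))"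
    using assms by (intro Plus_Succ) simp
  moreover have "T \<turnstile> Eq (Succ (Plus (Succ a) (numl n))) (Succ (Plus a (Succ (numl n))))"
    by (rule eq_Succ[OF Suc])
  moreover have "T \<turnstile> Eq (Plus a (Succ (Succ (numl n)))) (Succ (Plus a (Succ (numl n))))"
    using assms by (rule Plus_Succ)
  ultimately show ?case unfolding numl.simps by (meson eq_sym eq_trans)
qed

text \<open>In the induction step, \<open>x \<le> n\<close> makes \<open>x\<close> a numeral. If
  instead \<open>z + n = x\<close>, then \<open>z = 0\<close> gives \<open>x = n\<close>, and
  \<open>z = s(y)\<close> gives \<open>y + s(n) = x\<close>, that is
  \<open>n + 1 \<le> x\<close>.\<close>

lemma Le_total: "T \<turnstile> All 0 (Or (Le (Var 0) (numl n)) (Le (numl n) (Var 0)))"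
proof (induction n)
  case 0
  have "T \<turnstile> Ex 2 (Eq (Plus (Var 2) Zero) (Var 0))"
    by (rule ExI[where c = "Var 0"]) (auto intro: Plus_Zero)
  then have "T \<turnstile> Le Zero (Var 0)"
    by (rule ImpE[OF AndE2[OF Le_iff], rotated -1]) auto
  then show ?case by (auto intro: AllI[OF OrI2 fv_T])
next
  case (Suc n)
  let ?p = "Or (Le (Var 0) (numl (Suc n))) (Le (numl (Suc n)) (Var 0))"
  have eq_numl: "G \<turnstile> ?p" if "G \<turnstile> Eq (Var 0) (numl i)" "i \<le> Suc n" "T \<subseteq> G" for G i
    by (rule OrI1[OF Le_cong[OF eq_sym[OF that(1)] EqRefl]])
      (rule Weak[OF numl_Le], fact+)
  let ?G = "insert (Le (numl n) (Var 0)) T"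
  let ?H = "insert (Eq (Plus (Var 2) (numl n)) (Var 0)) ?G"
  let ?K = "insert (Neg (Eq (Var 2) Zero)) ?H"
  let ?L = "insert (Eq (Var 2) (Succ (Var 3))) ?K"
  have Ex: "?G \<turnstile> Ex 2 (Eq (Plus (Var 2) (numl n)) (Var 0))"
    by (rule prv_ImpD[OF AndE1[OF Le_iff]]) auto
  have "?K \<turnstile> Imp (Neg (Eq (Var 2) Zero)) (Ex 3 (Eq (Var 2) (Succ (Var 3))))"
    by (rule Weak[OF Succ_cases]) auto
  then have pre: "?K \<turnstile> Ex 3 (Eq (Var 2) (Succ (Var 3)))" by (rule ImpE) (rule prv_head)
  have "?L \<turnstile> Eq (Plus (Var 2) (numl n)) (Plus (Succ (Var 3)) (numl n))"
    by (intro eq_Plus EqRefl prv_head)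
  moreover have "?L \<turnstile> Eq (Plus (Succ (Var 3)) (numl n)) (Plus (Var 3) (Succ (numl n)))"
    by (rule Weak[OF Succ_Plus_numl]) auto
  moreover have "?L \<turnstile> Eq (Plus (Var 2) (numl n)) (Var 0)" by (rule Assm) simp
  ultimately have "?L \<turnstile> Eq (Plus (Var 3) (Succ (numl n))) (Var 0)"
    by (meson eq_sym eq_trans)
  then have "?L \<turnstile> Ex 2 (Eq (Plus (Var 2) (numl (Suc n))) (Var 0))"
    by (intro ExI[where c = "Var 3"]) auto
  moreover have "?L \<turnstile> Iff (Le (numl (Suc n)) (Var 0)) (Ex 2 (Eq (Plus (Var 2) (numl (Suc n))) (Var 0)))"
    by (rule Weak[OF Le_iff]) auto
  ultimately have "?L \<turnstile> ?p" by (blast intro: OrI2 ImpE AndE2)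
  then have "?K \<turnstile> ?p"
    by (rule ExE[OF pre]) (use fv_T in auto)
  moreover have "insert (Eq (Var 2) Zero) ?H \<turnstile> ?p"
  proof (rule eq_numl)
    let ?J = "insert (Eq (Var 2) Zero) ?H"
    have "?J \<turnstile> Eq (Plus (Var 2) (numl n)) (Plus (numl 0) (numl n))"
      by (intro eq_Plus EqRefl) (simp add: prv_head)
    moreover have "?J \<turnstile> Eq (Plus (numl 0) (numl n)) (numl (0 + n))"
      by (rule Weak[OF numl_Plus]) auto
    ultimately have "?J \<turnstile> Eq (Plus (Var 2) (numl n)) (numl n)"
      using eq_trans by fastforce
    moreover have "?J \<turnstile> Eq (Plus (Var 2) (numl n)) (Var 0)" by (rule Assm) simp
    ultimately show "?J \<turnstile> Eq (Var 0) (numl n)" by (rule eq_trans[OF eq_sym, rotated])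
  qed auto
  ultimately have "?H \<turnstile> ?p" by (blast intro: prv_cases)
  then have "?G \<turnstile> ?p"
    by (rule ExE[OF Ex]) (use fv_T in auto)
  moreover have "insert (Le (Var 0) (numl n)) T \<turnstile> ?p"
  proof (rule Le_numlE[OF prv_head])
    fix i assume "i \<le> n"
    then show "insert (Eq (Var 0) (numl i)) (insert (Le (Var 0) (numl n)) T) \<turnstile> ?p"
      by (intro eq_numl[OF prv_head]) auto
  qed auto
  moreover have "T \<turnstile> Or (Le (Var 0) (numl n)) (Le (numl n) (Var 0))"
    using AllE[OF Suc, of "Var 0"] by simp
  ultimately show ?case by (blast intro: AllI[OF OrE fv_T])
qed

text \<open>This and \<open>Lt_upperE\<close> supply the hypothesis \<open>upper\<close> of the
  lemmas on bounded quantifiers, for any bound whose value is known in the context.\<close>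

lemma Le_upperE:
  assumes a: "G \<turnstile> Eq a (numl n)" and TG: "T \<subseteq> G"
    and r: "\<And>i. i \<le> n \<Longrightarrow> insert (Eq b (numl i)) G \<turnstile> r"
  shows "insert (Le b a) G \<turnstile> r"
proof (rule Le_numlE)
  show "insert (Le b a) G \<turnstile> Le b (numl n)"
    by (rule Le_cong[OF EqRefl prv_weak[OF a] prv_head])
  show "insert (Eq b (numl i)) (insert (Le b a) G) \<turnstile> r" if "i \<le> n" for i
    using r[OF that] by (rule Weak) auto
qed (use TG in auto)

lemma Lt_upperE:
  assumes a: "G \<turnstile> Eq a (numl n)" and TG: "T \<subseteq> G"
    and r: "\<And>i. i < n \<Longrightarrow> insert (Eq b (numl i)) G \<turnstile> r"
  shows "insert (Lt b a) G \<turnstile> r"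
proof (rule prv_cut[OF AndE1[OF prv_head]], rule Le_upperE)
  show "insert (Lt b a) G \<turnstile> Eq a (numl n)" by (rule prv_weak[OF a])
  fix i assume "i \<le> n"
  let ?H = "insert (Eq b (numl i)) (insert (Lt b a) G)"
  show "?H \<turnstile> r"
  proof (cases "i = n")
    case True
    have "?H \<turnstile> Eq b a"
      unfolding True by (rule eq_trans[OF prv_head eq_sym[OF prv_weak[OF prv_weak[OF a]]]])
    moreover have "?H \<turnstile> Neg (Eq b a)" by (rule AndE2[OF Assm]) auto
    ultimately show ?thesis by (rule prv_contr)
  next
    case False
    with \<open>i \<le> n\<close> show ?thesis by (intro Weak[OF r]) auto
  qed
qed (use TG in auto)

lemma Le_of_eq:
  assumes "G \<turnstile> Eq a (numl n)" "G \<turnstile> Eq b (numl i)" "T \<subseteq> G" "i \<le> n"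
  shows "G \<turnstile> Le b a"
  using Le_cong[OF eq_sym[OF assms(2)] eq_sym[OF assms(1)] Weak[OF numl_Le]] assms(3,4) by blast

lemma Neg_Eq_of_eq:
  assumes "G \<turnstile> Eq a (numl n)" "G \<turnstile> Eq b (numl i)" "T \<subseteq> G" "i \<noteq> n"
  shows "G \<turnstile> Neg (Eq b a)"
proof (rule NegI)
  show "insert (Eq b a) G \<turnstile> Eq (numl i) (numl n)"
    by (rule Eq_cong[OF prv_weak[OF assms(2)] prv_weak[OF assms(1)] prv_head])
  show "insert (Eq b a) G \<turnstile> Neg (Eq (numl i) (numl n))"
    using assms(3) by (intro Weak[OF numl_neq[OF assms(4)]]) auto
qed

lemma Neg_Le_of_eq:
  assumes "G \<turnstile> Eq a (numl n)" "G \<turnstile> Eq b (numl i)" "T \<subseteq> G" "n < i"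
  shows "G \<turnstile> Neg (Le b a)"
proof (rule NegI)
  show "insert (Le b a) G \<turnstile> Le (numl i) (numl n)"
    by (rule Le_cong[OF prv_weak[OF assms(2)] prv_weak[OF assms(1)] prv_head])
  show "insert (Le b a) G \<turnstile> Neg (Le (numl i) (numl n))"
    using assms(3) by (intro Weak[OF numl_not_Le[OF assms(4)]]) auto
qed

section \<open>Deciding Delta_0 formulas; Sigma_1 formulas\<close>

text \<open>Provability of the true and refutability of the false formulas are proved together,
  since negation exchanges them. The first half yields Sigma_1 completeness, the second the refuted
  instances needed against omega-consistency.\<close>

lemma delta0_decides:
  "delta0 p \<Longrightarrow> T \<union> val_eqs e (fv p) \<turnstile> (if sat e p then p else Neg p)"
proof (induction p arbitrary: e rule: delta0.induct)
  case (1 a b)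
  let ?G = "T \<union> val_eqs e (fv (Eq a b))"
  have ev: "?G \<turnstile> Eq a (numl (tm_val e a))" "?G \<turnstile> Eq b (numl (tm_val e b))"
    by (rule tm_eval; auto simp: val_eqs_def intro: Assm)+
  show ?case
  proof (cases "tm_val e a = tm_val e b")
    case True
    then show ?thesis using eq_trans[OF ev(1) eq_sym] ev(2) by simp
  next
    case False
    then show ?thesis using Neg_Eq_of_eq[OF ev(2,1)] by simp
  qed
next
  case (2 a b)
  let ?G = "T \<union> val_eqs e (fv (Le a b))"
  have ev: "?G \<turnstile> Eq a (numl (tm_val e a))" "?G \<turnstile> Eq b (numl (tm_val e b))"
    by (rule tm_eval; auto simp: val_eqs_def intro: Assm)+
  then show ?case
    using Le_of_eq[OF ev(2,1)] Neg_Le_of_eq[OF ev(2,1)] by auto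
next
  case (3 p)
  have "T \<union> val_eqs e (fv p) \<turnstile> Neg (Neg p)" if "sat e p"
    using 3(2)[of e] that by (auto intro: NegI[OF prv_weak prv_head])
  with 3(2)[of e] show ?case by auto
next
  case (4 p q)
  let ?G = "T \<union> val_eqs e (fv (And p q))"
  have sub: "T \<union> val_eqs e (fv p) \<subseteq> ?G" "T \<union> val_eqs e (fv q) \<subseteq> ?G"
    by (auto simp: val_eqs_def)
  note ih = Weak[OF 4(3) sub(1)] Weak[OF 4(4) sub(2)]
  show ?case
  proof (cases "sat e (And p q)")
    case True
    with ih show ?thesis by (simp add: AndI)
  next
    case False
    then have "?G \<turnstile> Neg p \<or> ?G \<turnstile> Neg q" using ih by (auto split: if_splits)
    then have "?G \<turnstile> Neg (And p q)"
      by (auto intro: NegI[OF AndE1[OF prv_head] prv_weak] NegI[OF AndE2[OF prv_head] prv_weak])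
    then show ?thesis unfolding if_not_P[OF False] .
  qed
next
  case (5 p q)
  let ?G = "T \<union> val_eqs e (fv (Or p q))"
  have sub: "T \<union> val_eqs e (fv p) \<subseteq> ?G" "T \<union> val_eqs e (fv q) \<subseteq> ?G"
    by (auto simp: val_eqs_def)
  note ih = Weak[OF 5(3) sub(1)] Weak[OF 5(4) sub(2)]
  show ?case
  proof (cases "sat e (Or p q)")
    case True
    with ih show ?thesis by (auto intro: OrI1 OrI2 split: if_splits)
  next
    case False
    then have n: "?G \<turnstile> Neg p" "?G \<turnstile> Neg q" using ih by (auto split: if_splits)
    have "?G \<turnstile> Neg (Or p q)"
      by (rule NegI_self, rule OrE[OF prv_head])
        (rule prv_contr[OF prv_head prv_weak[OF prv_weak]], rule n)+
    then show ?thesis unfolding if_not_P[OF False] .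
  qed
next
  case (6 p q)
  let ?G = "T \<union> val_eqs e (fv (Imp p q))"
  have sub: "T \<union> val_eqs e (fv p) \<subseteq> ?G" "T \<union> val_eqs e (fv q) \<subseteq> ?G"
    by (auto simp: val_eqs_def)
  note ih = Weak[OF 6(3) sub(1)] Weak[OF 6(4) sub(2)]
  show ?case
  proof (cases "sat e (Imp p q)")
    case True
    then have "?G \<turnstile> Neg p \<or> ?G \<turnstile> q" using ih by (auto split: if_splits)
    then have "?G \<turnstile> Imp p q"
      by (auto intro: ImpI[OF prv_weak] ImpI[OF prv_contr[OF prv_head prv_weak]])
    then show ?thesis unfolding if_P[OF True] .
  next
    case False
    then have "?G \<turnstile> p" "?G \<turnstile> Neg q" using ih by (auto split: if_splits)
    then have "?G \<turnstile> Neg (Imp p q)"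
      by (intro NegI[OF ImpE[OF prv_head prv_weak] prv_weak])
    then show ?thesis unfolding if_not_P[OF False] .
  qed
next
  case (7 p x a)
  let ?G = "T \<union> val_eqs e (fv (all_le x a p))" and ?n = "tm_val e a"
  have a: "?G \<turnstile> Eq a (numl ?n)"
    using 7(2) by (intro tm_eval) (auto simp: val_eqs_def intro: Assm)
  \<comment> \<open>The bound does not contain \<open>x\<close>, so its value survives the update of
    \<open>e\<close>, and the range of the quantifier is fixed in advance.\<close>
  have sat: "sat e (all_le x a p) \<longleftrightarrow> (\<forall>i\<in>{..?n}. sat (e(x := i)) p)"
    by (auto simp: tm_val_upd 7(2) less_le)
  show ?case unfolding sat
  proof (rule bounded_All_decides)
    show "\<forall>r\<in>?G. x \<notin> fv r" using fv_T by (auto simp: val_eqs_def)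
    show "insert (Le (Var x) a) ?G \<turnstile> r"
      if "\<And>i. i \<in> {..?n} \<Longrightarrow> insert (Eq (Var x) (numl i)) ?G \<turnstile> r" for r
      by (rule Le_upperE[OF a _ that]) auto
    show "insert (Eq (Var x) (numl i)) ?G \<turnstile> Le (Var x) a" if "i \<in> {..?n}" for i
      using that by (intro Le_of_eq[OF prv_weak[OF a] prv_head]) auto
    show "insert (Eq (Var x) (numl i)) ?G \<turnstile> (if sat (e(x := i)) p then p else Neg p)" for i
      by (rule 7(3)[THEN Weak]) (auto simp: val_eqs_def)
  qed
next
  case (8 p x a)
  let ?G = "T \<union> val_eqs e (fv (ex_le x a p))" and ?n = "tm_val e a"
  have a: "?G \<turnstile> Eq a (numl ?n)"
    using 8(2) by (intro tm_eval) (auto simp: val_eqs_def intro: Assm)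
  have sat: "sat e (ex_le x a p) \<longleftrightarrow> (\<exists>i\<in>{..?n}. sat (e(x := i)) p)"
    by (auto simp: tm_val_upd 8(2) less_le)
  show ?case unfolding sat
  proof (rule bounded_Ex_decides)
    show "\<forall>r\<in>?G. x \<notin> fv r" using fv_T by (auto simp: val_eqs_def)
    show "insert (Le (Var x) a) ?G \<turnstile> r"
      if "\<And>i. i \<in> {..?n} \<Longrightarrow> insert (Eq (Var x) (numl i)) ?G \<turnstile> r" for r
      by (rule Le_upperE[OF a _ that]) auto
    show "insert (Eq (Var x) (numl i)) ?G \<turnstile> Le (Var x) a" if "i \<in> {..?n}" for i
      using that by (intro Le_of_eq[OF prv_weak[OF a] prv_head]) auto
    show "insert (Eq (Var x) (numl i)) ?G \<turnstile> (if sat (e(x := i)) p then p else Neg p)" for i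
      by (rule 8(3)[THEN Weak]) (auto simp: val_eqs_def)
  qed
next
  case (9 p x a)
  let ?G = "T \<union> val_eqs e (fv (all_lt x a p))" and ?n = "tm_val e a"
  have a: "?G \<turnstile> Eq a (numl ?n)"
    using 9(2) by (intro tm_eval) (auto simp: val_eqs_def intro: Assm)
  have sat: "sat e (all_lt x a p) \<longleftrightarrow> (\<forall>i\<in>{..<?n}. sat (e(x := i)) p)"
    by (auto simp: tm_val_upd 9(2) less_le)
  show ?case unfolding sat
  proof (rule bounded_All_decides)
    show "\<forall>r\<in>?G. x \<notin> fv r" using fv_T by (auto simp: val_eqs_def)
    show "insert (Lt (Var x) a) ?G \<turnstile> r"
      if "\<And>i. i \<in> {..<?n} \<Longrightarrow> insert (Eq (Var x) (numl i)) ?G \<turnstile> r" for r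
      by (rule Lt_upperE[OF a _ that]) auto
    show "insert (Eq (Var x) (numl i)) ?G \<turnstile> Lt (Var x) a" if "i \<in> {..<?n}" for i
      using that by (intro AndI Le_of_eq[OF prv_weak[OF a] prv_head]
          Neg_Eq_of_eq[OF prv_weak[OF a] prv_head]) auto
    show "insert (Eq (Var x) (numl i)) ?G \<turnstile> (if sat (e(x := i)) p then p else Neg p)" for i
      by (rule 9(3)[THEN Weak]) (auto simp: val_eqs_def)
  qed
next
  case (10 p x a)
  let ?G = "T \<union> val_eqs e (fv (ex_lt x a p))" and ?n = "tm_val e a"
  have a: "?G \<turnstile> Eq a (numl ?n)"
    using 10(2) by (intro tm_eval) (auto simp: val_eqs_def intro: Assm)
  have sat: "sat e (ex_lt x a p) \<longleftrightarrow> (\<exists>i\<in>{..<?n}. sat (e(x := i)) p)"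
    by (auto simp: tm_val_upd 10(2) less_le)
  show ?case unfolding sat
  proof (rule bounded_Ex_decides)
    show "\<forall>r\<in>?G. x \<notin> fv r" using fv_T by (auto simp: val_eqs_def)
    show "insert (Lt (Var x) a) ?G \<turnstile> r"
      if "\<And>i. i \<in> {..<?n} \<Longrightarrow> insert (Eq (Var x) (numl i)) ?G \<turnstile> r" for r
      by (rule Lt_upperE[OF a _ that]) auto
    show "insert (Eq (Var x) (numl i)) ?G \<turnstile> Lt (Var x) a" if "i \<in> {..<?n}" for i
      using that by (intro AndI Le_of_eq[OF prv_weak[OF a] prv_head]
          Neg_Eq_of_eq[OF prv_weak[OF a] prv_head]) auto
    show "insert (Eq (Var x) (numl i)) ?G \<turnstile> (if sat (e(x := i)) p then p else Neg p)" for i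
      by (rule 10(3)[THEN Weak]) (auto simp: val_eqs_def)
  qed
qed

lemma sigma1_complete:
  assumes "sigma1 p" "sat e p"
  shows "T \<union> val_eqs e (fv p) \<turnstile> p"
proof -
  obtain x m where p: "p = Ex x m" and m: "delta0 m" using assms(1) by (auto simp: sigma1_def)
  obtain j where j: "sat (e(x := j)) m" using assms(2) p by auto
  have "T \<union> val_eqs (e(x := j)) (fv m) \<turnstile> m"
    using delta0_decides[OF m, of "e(x := j)"] j by simp
  then have "insert (Eq (Var x) (numl j)) (T \<union> val_eqs e (fv p)) \<turnstile> m"
    by (rule Weak) (auto simp: val_eqs_def p)
  then have "T \<union> val_eqs e (fv p) \<turnstile> subst x (numl j) m"
    by (rule prv_subst_of_eq) (use fv_T in \<open>auto simp: p val_eqs_def intro: EqRefl\<close>)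
  then show ?thesis unfolding p by (rule ExI) simp
qed

text \<open>Values are known for the open formula under equations with numerals, whereas the
  instance contains \<open>t\<close>; its provable value is what connects them.\<close>

lemma prv_inst2:
  assumes "insert (Eq (Var 0) (numl i)) (insert (Eq (Var 1) (numl j)) T) \<turnstile> p"
    and "T \<turnstile> Eq t (numl j)" "tm_vars t = {}"
  shows "T \<turnstile> inst2 p (numl i) t"
  unfolding inst2_def
proof (rule prv_subst_of_eq)
  show "insert (Eq (Var 1) (numl j)) T \<turnstile> subst 0 (numl i) p"
    by (rule prv_subst_of_eq[OF assms(1)]) (use fv_T in \<open>auto intro: EqRefl\<close>)
qed (use assms fv_T in auto)

lemma sigma1_inst2_complete:
  assumes "sigma1 p" "fv p \<subseteq> {0, 1}" "sat e p" "T \<turnstile> Eq t (numl (e 1))" "tm_vars t = {}"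
  shows "T \<turnstile> inst2 p (numl (e 0)) t"
proof (rule prv_inst2)
  show "insert (Eq (Var 0) (numl (e 0))) (insert (Eq (Var 1) (numl (e 1))) T) \<turnstile> p"
    using sigma1_complete[OF assms(1,3)] by (rule Weak) (use assms(2) in \<open>auto simp: val_eqs_def\<close>)
qed fact+

lemma sigma1_inst2_omega_sound:
  assumes "omega_consistent T" "sigma1 p" "fv p \<subseteq> {0, 1}" "\<not> sat e p"
    and t: "T \<turnstile> Eq t (numl (e 1))" "tm_vars t = {}"
  shows "\<not> T \<turnstile> inst2 p (numl (e 0)) t"
proof
  assume prv: "T \<turnstile> inst2 p (numl (e 0)) t"
  obtain x m where p: "p = Ex x m" and m: "delta0 m" using assms(2) by (auto simp: sigma1_def)
  have neg: "G \<turnstile> Neg m" if "T \<union> val_eqs (e(x := j)) (insert x {0, 1}) \<subseteq> G" for j G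
  proof -
    have "T \<union> val_eqs (e(x := j)) (fv m) \<turnstile> Neg m"
      using delta0_decides[OF m, of "e(x := j)"] assms(4) p by (auto split: if_splits)
    then show ?thesis
      by (rule Weak) (use that assms(3) p in \<open>auto simp: val_eqs_def\<close>)
  qed
  obtain m' where m': "inst2 p (numl (e 0)) t = Ex x m'" "fv m' \<subseteq> {x}"
    "\<And>j. T \<turnstile> Neg (subst x (numl j) m')"
  proof -
    \<comment> \<open>The bound variable of the Sigma_1 formula may be \<open>v_0\<close> or
      \<open>v_1\<close> itself. Then the corresponding substitution stops at the quantifier, and
      the matrix of the instance is a different one.\<close>
    consider "x = 0" | "x = 1" | "x \<noteq> 0" "x \<noteq> 1" by blast
    then show ?thesis
    proof cases
      case 1
      have "T \<turnstile> subst 0 (numl j) (subst 1 t (Neg m))" for j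
      proof (intro prv_subst_of_eq)
        show "insert (Eq (Var 1) (numl (e 1))) (insert (Eq (Var 0) (numl j)) T) \<turnstile> Neg m"
          using 1 by (intro neg[of j]) (auto simp: val_eqs_def)
      qed (use fv_T t in \<open>auto intro: EqRefl prv_weak\<close>)
      with that[of "subst 1 t m"] 1 assms(3) t show ?thesis
        by (auto simp: p inst2_def fv_subst_closed)
    next
      case 2
      have "T \<turnstile> subst 1 (numl j) (subst 0 (numl (e 0)) (Neg m))" for j
      proof (intro prv_subst_of_eq)
        show "insert (Eq (Var 0) (numl (e 0))) (insert (Eq (Var 1) (numl j)) T) \<turnstile> Neg m"
          using 2 by (intro neg[of j]) (auto simp: val_eqs_def)
      qed (use fv_T t in \<open>auto intro: EqRefl prv_weak\<close>)
      with that[of "subst 0 (numl (e 0)) m"] 2 assms(3) show ?thesis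
        by (auto simp: p inst2_def fv_subst_closed)
    next
      case 3
      have "T \<turnstile> subst x (numl j) (subst 1 t (subst 0 (numl (e 0)) (Neg m)))" for j
      proof (intro prv_subst_of_eq)
        show "insert (Eq (Var 0) (numl (e 0))) (insert (Eq (Var 1) (numl (e 1)))
            (insert (Eq (Var x) (numl j)) T)) \<turnstile> Neg m"
          using 3 by (intro neg[of j]) (auto simp: val_eqs_def)
      qed (use fv_T t 3 in \<open>auto intro: EqRefl prv_weak\<close>)
      with that[of "subst 1 t (subst 0 (numl (e 0)) m)"] 3 assms(3) t show ?thesis
        by (auto simp: p inst2_def fv_subst_closed)
    qed
  qed
  with prv assms(1) show False by (auto simp: omega_consistent_def)
qed

section \<open>Naming\<close>

lemma names_unique:
  assumes "consistent T" "names T m i" "names T m j" shows "i = j"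
proof (rule ccontr)
  assume "i \<noteq> j"
  have "T \<turnstile> subst 0 (numl i) (Iff m (Eq (Var 0) (numl l)))" if "names T m l" for l
    using that unfolding names_def by (blast intro: AllE free_for_numl)
  then have inst: "T \<turnstile> Iff (subst 0 (numl i) m) (Eq (numl i) (numl l))" if "names T m l" for l
    using that by simp
  have "T \<turnstile> subst 0 (numl i) m" by (rule ImpE[OF AndE2[OF inst] EqRefl]) fact
  then have "T \<turnstile> Eq (numl i) (numl j)" by (rule ImpE[OF AndE1[OF inst], rotated]) fact
  with numl_neq[OF \<open>i \<noteq> j\<close>] assms(1) show False by (auto simp: consistent_def)
qed

text \<open>\<open>psi q\<close> says that \<open>v_0\<close> is the least number failing
  \<open>q\<close>. By \<open>Le_total\<close> there are two cases: \<open>v_0 \<le> n\<close> makes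
  \<open>v_0\<close> a numeral, which cannot be below \<open>n\<close> because \<open>q\<close> is
  provable there; and \<open>n < v_0\<close> would give \<open>q\<close> at \<open>n\<close> by
  minimality. For the converse, everything below \<open>v_0 = n\<close> is again a numeral.\<close>

lemma names_psi:
  assumes q: "fv q \<subseteq> {0}" "free_for (Var 2) 0 q"
    and less: "\<And>i. i < n \<Longrightarrow> T \<turnstile> subst 0 (numl i) q" and n: "T \<turnstile> Neg (subst 0 (numl n) q)"
  shows "names T (psi q) n"
proof -
  let ?r = "subst 0 (Var 2) q"
  have r: "subst 2 c ?r = subst 0 c q" for c
    using q by (intro subst_Var_subst) auto
  have transport: "G \<turnstile> subst 0 b p" if "G \<turnstile> Eq a b" "G \<turnstile> subst 0 a p"
    "free_for a 0 p" "free_for b 0 p" for G a b p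
    using that by (rule EqSubst)
  have fvr: "fv ?r \<subseteq> {2}" using fv_subst_Var[of 0 2 q] q by auto
  have "insert (psi q) T \<turnstile> Eq (Var 0) (numl n)"
  proof -
    let ?G = "insert (psi q) T"
    have psi: "?G \<turnstile> psi q" by (rule prv_head)
    have notq: "?G \<turnstile> Neg q" using psi unfolding psi_def by (rule AndE1)
    have all: "?G \<turnstile> all_lt 2 (Var 0) ?r" using psi unfolding psi_def by (rule AndE2)
    have "?G \<turnstile> subst 2 (numl n) (Imp (Lt (Var 2) (Var 0)) ?r)"
      by (rule AllE[OF all]) simp
    then have below: "?G \<turnstile> Imp (Lt (numl n) (Var 0)) (subst 0 (numl n) q)" by (simp add: r)
    have "T \<turnstile> subst 0 (Var 0) (Or (Le (Var 0) (numl n)) (Le (numl n) (Var 0)))"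
      by (rule AllE[OF Le_total]) simp
    then have "?G \<turnstile> Or (Le (Var 0) (numl n)) (Le (numl n) (Var 0))"
      by (simp add: prv_weak)
    then show ?thesis
    proof (rule OrE)
      show "insert (Le (Var 0) (numl n)) ?G \<turnstile> Eq (Var 0) (numl n)"
      proof (rule Le_numlE[OF prv_head])
        fix i assume "i \<le> n"
        let ?H = "insert (Eq (Var 0) (numl i)) (insert (Le (Var 0) (numl n)) ?G)"
        show "?H \<turnstile> Eq (Var 0) (numl n)"
        proof (cases "i = n")
          case True
          then show ?thesis by (simp add: prv_head)
        next
          case False
          with \<open>i \<le> n\<close> have "T \<turnstile> subst 0 (numl i) q" by (intro less) simp
          then have "?H \<turnstile> subst 0 (Var 0) q"
            by (intro transport[OF eq_sym[OF prv_head]] prv_weak) auto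
          then have "?H \<turnstile> q" by simp
          moreover have "?H \<turnstile> Neg q" by (intro prv_weak notq)
          ultimately show ?thesis by (rule prv_contr)
        qed
      qed auto
      let ?K = "insert (Le (numl n) (Var 0)) ?G"
      show "?K \<turnstile> Eq (Var 0) (numl n)"
      proof (rule Raa)
        let ?L = "insert (Neg (Eq (Var 0) (numl n))) ?K"
        have "?L \<turnstile> Neg (Eq (numl n) (Var 0))"
          by (rule NegI[OF eq_sym[OF prv_head]]) (auto intro: Assm)
        moreover have "?L \<turnstile> Le (numl n) (Var 0)" by (rule Assm) simp
        ultimately have "?L \<turnstile> Lt (numl n) (Var 0)" by (intro AndI)
        then show "?L \<turnstile> subst 0 (numl n) q"
          by (rule ImpE[OF prv_weak[OF prv_weak[OF below]]])
        show "?L \<turnstile> Neg (subst 0 (numl n) q)" by (intro prv_weak n)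
      qed
    qed
  qed
  moreover have "insert (Eq (Var 0) (numl n)) T \<turnstile> psi q"
    unfolding psi_def
  proof (intro AndI AllI ImpI)
    let ?G = "insert (Eq (Var 0) (numl n)) T"
    have "?G \<turnstile> subst 0 (Var 0) (Neg q)"
      by (rule transport[OF eq_sym[OF prv_head]]) (auto intro: prv_weak n)
    then show "?G \<turnstile> Neg q" by simp
    show "insert (Lt (Var 2) (Var 0)) ?G \<turnstile> ?r"
    proof (rule Lt_upperE[OF prv_head])
      fix i assume "i < n"
      then have "T \<turnstile> subst 2 (numl i) ?r" using less r by simp
      then have "insert (Eq (Var 2) (numl i)) ?G \<turnstile> subst 2 (Var 2) ?r"
        by (intro EqSubst[OF eq_sym[OF prv_head]] prv_weak) auto
      then show "insert (Eq (Var 2) (numl i)) ?G \<turnstile> ?r" by simp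
    qed auto
    show "\<forall>r\<in>?G. 2 \<notin> fv r" using fv_T by auto
  qed
  ultimately have "T \<turnstile> All 0 (Iff (psi q) (Eq (Var 0) (numl n)))"
    by (intro AllI[OF IffI fv_T])
  moreover have "fv (psi q) \<subseteq> {0}" using q fvr by (auto simp: psi_def)
  ultimately show ?thesis by (simp add: names_def)
qed

end

section \<open>Names with few variables and the existence of an unnamed number\<close>

lemma card_vars_le_len: "card (vars p) \<le> len p"
proof -
  have tm: "SVar ` tm_vars a \<subseteq> set (tm_syms a)" for a by (induction a) auto
  have "SVar ` vars p \<subseteq> set (syms p)" using tm by (induction p) fastforce+
  then have "card (SVar ` vars p) \<le> card (set (syms p))" by (intro card_mono) auto
  also have "\<dots> \<le> len p" unfolding len_def by (rule card_length)
  finally show ?thesis by (simp add: card_image inj_on_def)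
qed

lemma names_bounded_vars:
  assumes "names T m i" "len m < l"
  obtains m' where "vars m' \<subseteq> {..<l}" "len m' = len m" "names T m' i"
proof -
  \<comment> \<open>Naming refers to \<open>v_0\<close>, so \<open>0\<close> must stay fixed and the
    other variables have to fit into \<open>{1..<l}\<close>. The strict inequality
    \<open>len m < l\<close> leaves exactly this room, even if \<open>v_0\<close> does not occur in
    \<open>m\<close>.\<close>
  have "card (vars m - {0}) \<le> card (vars m)" by (intro card_mono finite_vars) auto
  with card_vars_le_len[of m] assms(2) have "card (vars m - {0}) \<le> card {1..<l}" by simp
  then obtain h where h: "h ` (vars m - {0}) \<subseteq> {1..<l}" "inj_on h (vars m - {0})"
    using card_le_inj[of "vars m - {0}" "{1..<l}"] finite_vars by auto
  define f where "f = h(0 := 0)"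
  have "inj_on f (vars m - {0})" using h(2) by (simp add: f_def inj_on_def)
  moreover have "f 0 \<notin> f ` (vars m - {0})" using h(1) by (auto simp: f_def)
  ultimately have "inj_on f (insert 0 (vars m - {0}))"
    by (simp only: inj_on_insert Diff_idemp simp_thms)
  then have inj: "inj_on f (insert 0 (vars m))" by (simp only: insert_Diff_single)
  have f0: "f 0 = 0" by (simp add: f_def)
  \<comment> \<open>The whole naming sentence is renamed, since \<open>rename_prv\<close> concerns
    sentences; as \<open>f\<close> fixes \<open>0\<close>, the result is again a naming sentence for
    \<open>i\<close>.\<close>
  let ?s = "All 0 (Iff m (Eq (Var 0) (numl i)))"
  have "T \<turnstile> ?s \<longleftrightarrow> T \<turnstile> rename f ?s"
    using assms(1) inj by (intro rename_prv) (auto simp: names_def insert_absorb)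
  moreover have "fv (rename f m) \<subseteq> {0}"
    using assms(1) inj fv_rename[of f m] f0 by (auto simp: names_def)
  ultimately have "names T (rename f m) i"
    using assms(1) f0 by (simp add: names_def)
  moreover have "vars (rename f m) \<subseteq> {..<l}"
    using h assms(2) by (auto simp: vars_rename f_def)
  ultimately show ?thesis using that len_rename by blast
qed

lemma naming_rel_iff:
  assumes "code_bound g"
  shows "(i, l) \<in> naming_rel T g \<longleftrightarrow> (\<exists>m. len m < l \<and> names T m i)"
proof
  assume "\<exists>m. len m < l \<and> names T m i"
  then obtain m where m: "len m < l" "names T m i" by blast
  obtain m' where m': "vars m' \<subseteq> {..<l}" "len m' = len m" "names T m' i"
    using names_bounded_vars[OF m(2,1)] .
  then have "gn m' < g l" using assms m(1) by (simp add: code_bound_def)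
  with m m' show "(i, l) \<in> naming_rel T g" by (auto simp: naming_rel_def)
qed (auto simp: naming_rel_def)

text \<open>\<open>LEAST\<close> has its intended meaning only if some number is unnamed. There are
  finitely many codes below \<open>g l\<close>, and in a consistent theory each formula names at
  most one number.\<close>

lemma (in Q_extension) least_unnamed_unnamed:
  assumes "consistent T" "code_bound g"
  shows "\<not> (\<exists>m. len m < l \<and> names T m (least_unnamed T l))"
proof -
  have "finite {m. gn m < g l}"
    using finite_vimageI[of "{..<g l}" gn] by (auto simp: inj_def gn_inject vimage_def)
  \<comment> \<open>For formulas that name nothing the value of \<open>THE\<close> is arbitrary,
    which is harmless for an inclusion.\<close>
  moreover have "{i. \<exists>m. len m < l \<and> names T m i} \<subseteq> (\<lambda>m. THE i. names T m i) ` {m. gn m < g l}"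
  proof
    fix i assume "i \<in> {i. \<exists>m. len m < l \<and> names T m i}"
    then have "(i, l) \<in> naming_rel T g" by (simp add: naming_rel_iff[OF assms(2)])
    then obtain m where m: "gn m < g l" "names T m i" by (auto simp: naming_rel_def)
    have "(THE i. names T m i) = i" using m(2) names_unique[OF assms(1)] by blast
    with m show "i \<in> (\<lambda>m. THE i. names T m i) ` {m. gn m < g l}" by blast
  qed
  ultimately have "finite {i. \<exists>m. len m < l \<and> names T m i}" by (rule finite_surj)
  then obtain i where "i \<notin> {i. \<exists>m. len m < l \<and> names T m i}"
    using ex_new_if_finite[OF infinite_UNIV_nat] by blast
  then have "\<not> (\<exists>m. len m < l \<and> names T m i)" by blast
  then show ?thesis unfolding least_unnamed_def by (rule LeastI)
qed

section \<open>Lengths\<close>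

lemma length_tm_syms_numl: "length (tm_syms (numl i)) = Suc i"
  by (induction i) auto

text \<open>Each replaced variable gives up one symbol; it is added on the left to avoid subtraction
  of natural numbers.\<close>

lemma length_tm_syms_subst:
  "length (tm_syms (tm_subst x c a)) + tm_occ x a = length (tm_syms a) + tm_occ x a * length (tm_syms c)"
  by (induction a) (auto simp: algebra_simps)

lemma len_subst:
  "len (subst x c p) + free_occ x p = len p + free_occ x p * length (tm_syms c)"
proof (induction p)
  case (Eq a b)
  show ?case
    using length_tm_syms_subst[of x c a] length_tm_syms_subst[of x c b]
    by (simp add: len_def algebra_simps)
next
  case (Le a b)
  show ?case
    using length_tm_syms_subst[of x c a] length_tm_syms_subst[of x c b]
    by (simp add: len_def algebra_simps)
qed (auto simp: len_def algebra_simps)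

lemma len_subst_psi_less:
  assumes "k2 > free_occ 1 (psi p)"
  shows "len (subst 1 (term_t p k2) (psi p)) < value_t p k2"
proof -
  define k1 k occ where "k1 = len (psi p)" and "k = k1 * k2" and "occ = free_occ 1 (psi p)"
  \<comment> \<open>The numeral for 10 has 11 symbols, the two numerals for \<open>k\<close> have
    \<open>k + 1\<close> each, and the two products add four parentheses and two signs.\<close>
  have "length (tm_syms (term_t p k2)) = 2 * k + 19"
    by (simp add: term_t_def bound_k_def length_tm_syms_numl k_def k1_def)
  then have "len (subst 1 (term_t p k2) (psi p)) = k1 + occ * (2 * k + 18)"
    using len_subst[of 1 "term_t p k2" "psi p"] by (simp add: k1_def occ_def algebra_simps)
  moreover have "occ * (2 * k + 18) \<le> k2 * (2 * k + 18)"
    using assms by (intro mult_right_mono) (auto simp: occ_def)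
  \<comment> \<open>The bound 9 turns \<open>18 * k2\<close> into at most \<open>2 * k\<close>. The
    total is then at most \<open>k + 2 * k * k + 2 * k\<close>, hence at most
    \<open>5 * k * k\<close>, which leaves ample room below \<open>10 * k * k\<close>.\<close>
  moreover have k1: "k1 \<ge> 9" by (simp add: k1_def psi_def len_def)
  then have "9 * k2 \<le> k" unfolding k_def by (rule mult_right_mono) simp
  \<comment> \<open>The strict inequality for \<open>k2\<close> makes it positive even if
    \<open>v_1\<close> has no free occurrence.\<close>
  moreover have "k1 \<le> k" using assms by (simp add: k_def)
  moreover have "k2 * k \<le> k * k" using k1 by (intro mult_right_mono) (auto simp: k_def)
  moreover have "k \<le> k * k" by simp
  moreover have "k > 0" using k1 assms by (simp add: k_def)
  then have "k * k > 0" by simp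
  moreover have "value_t p k2 = 10 * (k * k)"
    by (simp add: value_t_def bound_k_def k_def k1_def power2_eq_square)
  moreover have "k2 * (2 * k + 18) = 2 * (k2 * k) + 18 * k2" by (simp add: algebra_simps)
  ultimately show ?thesis by linarith
qed

section \<open>The unprovability of both instances\<close>

text \<open>The left side is the form in which the formula is shown to name \<open>n\<close>, the
  right side the one whose length is computed.\<close>

lemma psi_subst_closed: "tm_vars c = {} \<Longrightarrow> psi (subst 1 c p) = subst 1 c (psi p)"
  by (simp add: psi_def subst_commute_closed)

lemma omega_consistent_imp_consistent: "omega_consistent T \<Longrightarrow> consistent T"
  unfolding consistent_def
proof (intro notI, elim exE conjE)
  fix p assume omega: "omega_consistent T" and p: "T \<turnstile> p" "T \<turnstile> Neg p"
  have "fv (Eq (Var 0) (Var 0)) \<subseteq> {0}" by simp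
  with omega prv_contr[OF p] show False unfolding omega_consistent_def by blast
qed

theorem corollary3:
  fixes T :: "fm set" and g :: "nat \<Rightarrow> nat" and \<phi> :: fm and k2 n :: nat and t :: tm
  assumes "rec_axiomatizable T"
    and "extends_Q T"
    and "code_bound g"
    and "sigma1 \<phi>"
    and "defines_rel \<phi> (naming_rel T g)"
    and "free_for (Var 2) 0 \<phi>"
    and "k2 > free_occ 1 (psi \<phi>)"
    and "t = term_t \<phi> k2"
    and "n = least_unnamed T (value_t \<phi> k2)"
  shows "(consistent T \<longrightarrow> \<not> T \<turnstile> Neg (inst2 \<phi> (numl n) t)) \<and>
         (omega_consistent T \<longrightarrow> \<not> T \<turnstile> inst2 \<phi> (numl n) t)"
proof -
  interpret Q_extension T by standard fact
  define l where "l = value_t \<phi> k2"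
  have closed: "tm_vars t = {}" by (simp add: assms(8) term_t_def)
  have "tm_val e t = l" for e
  proof -
    have numl: "tm_val e (numl i) = i" for i by (induction i) auto
    show ?thesis
      by (simp add: assms(8) term_t_def l_def value_t_def numl power2_eq_square del: numl.simps)
  qed
  then have t: "T \<turnstile> Eq t (numl l)" using tm_eval[of T t] closed by simp
  have fv: "fv \<phi> \<subseteq> {0, 1}" and sat: "sat e \<phi> \<longleftrightarrow> (\<exists>m. len m < e 1 \<and> names T m (e 0))" for e
    using assms(5) by (auto simp: defines_rel_def naming_rel_iff[OF assms(3)])
  have unnamed: "\<not> (\<exists>m. len m < l \<and> names T m n)" if "consistent T"
    using least_unnamed_unnamed[OF that assms(3)] by (simp add: assms(9) l_def)
  \<comment> \<open>\<open>inst2\<close> inserts the numeral first, but the name arises by inserting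
    \<open>t\<close> first and keeping \<open>v_0\<close> free; for closed terms the order is
    immaterial.\<close>
  have inst: "inst2 \<phi> (numl i) t = subst 0 (numl i) (subst 1 t \<phi>)" for i
    by (simp add: inst2_def closed subst_commute_closed)
  have "\<not> T \<turnstile> Neg (inst2 \<phi> (numl n) t)" if "consistent T"
  proof
    assume neg: "T \<turnstile> Neg (inst2 \<phi> (numl n) t)"
    have "names T (psi (subst 1 t \<phi>)) n"
    proof (rule names_psi)
      show "fv (subst 1 t \<phi>) \<subseteq> {0}" using fv closed by (auto simp: fv_subst_closed)
      show "free_for (Var 2) 0 (subst 1 t \<phi>)"
        using closed assms(6) by (rule free_for_subst_closed)
      show "T \<turnstile> Neg (subst 0 (numl n) (subst 1 t \<phi>))" using neg by (simp add: inst)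
      fix i assume "i < n"
      \<comment> \<open>Minimality of \<open>n\<close> alone gives a short name for
        \<open>i\<close>, so the instance of the Sigma_1 formula at \<open>i\<close> is true and
        provable.\<close>
      then have "\<exists>m. len m < l \<and> names T m i"
        using not_less_Least unfolding assms(9) least_unnamed_def l_def by blast
      then have "T \<turnstile> inst2 \<phi> (numl i) t"
        using sigma1_inst2_complete[OF assms(4) fv, of "\<lambda>x. if x = 0 then i else l"] t closed
        by (simp add: sat)
      then show "T \<turnstile> subst 0 (numl i) (subst 1 t \<phi>)" by (simp add: inst)
    qed
    moreover have "len (psi (subst 1 t \<phi>)) < l"
      using len_subst_psi_less[OF assms(7)] psi_subst_closed[OF closed, of \<phi>]
      by (simp only: l_def assms(8))
    ultimately show False using unnamed[OF that] by blast
  qed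
  \<comment> \<open>Consistency, a consequence of omega-consistency, is what makes \<open>n\<close>
    really unnamed and thus the instance false.\<close>
  moreover have "\<not> T \<turnstile> inst2 \<phi> (numl n) t" if "omega_consistent T"
    using sigma1_inst2_omega_sound[OF that assms(4) fv, of "\<lambda>x. if x = 0 then n else l"]
      t closed unnamed[OF omega_consistent_imp_consistent[OF that]]
    by (simp add: sat)
  ultimately show ?thesis by blast
qed

end
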